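(* Consider the regression model $y=X\beta+\epsilon$ with $\epsilon\sim\mathcal E_n(0,\sigma^2V,g)$, and the quadratic risk $R(\beta^*;\beta)=E[(\beta^*-\beta)'\mathbf W(\beta^*-\beta)]$ for a given positive definite $p\times p$ matrix $\mathbf W$. Let $q\ge3$, $m=n-p$, $d=\frac{(q-2)m}{q(m+2)}$, and let $$\hat\beta^S=\tilde\beta-d\,\mathcal L_n^{-1}(\tilde\beta-\hat\beta),\qquad \hat\beta^{S+}=\hat\beta+(1-d\,\mathcal L_n^{-1})\,I(\mathcal L_n>d)\,(\tilde\beta-\hat\beta)$$ be the Stein-type and positive-rule shrinkage estimators. Then for all $\beta\in\mathbb R^p$, $$R(\hat\beta^{S+};\beta)\le R(\hat\beta^{S};\beta).$$
   Context: Model: $y=X\beta+\epsilon$, where $X$ is a fixed $n\times p$ matrix of full column rank $p<n$, $V$ is a known positive definite $n\times n$ matrix, $\beta\in\mathbb R^p$ and $\sigma>0$ are unknown, and $\epsilon\sim\mathcal E_n(0,\sigma^2V,g)$ has density $|\sigma^2V|^{-1/2}g(\epsilon'V^{-1}\epsilon/\sigma^2)$ of the form $$f_\epsilon(x)=\int_0^\infty \phi_{N_n(0,t^{-1}\sigma^2V)}(x)\,\mathcal W(dt),$$ where $\phi_{N_n(0,\Sigma)}$ is the density of $N_n(0,\Sigma)$ and $\mathcal W$ is a (possibly signed) measure on $(0,\infty)$, not depending on $\beta,\sigma$, with $\int_0^\infty\mathcal W(dt)=1$ and with Jordan decomposition $\mathcal W=\mathcal W^+-\mathcal W^-$ satisfying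 $\int t^{-1}\mathcal W^\pm(dt)<\infty$. Estimators: $C=X'V^{-1}X$; $\tilde\beta=C^{-1}X'V^{-1}y$; $S^2=(y-X\tilde\beta)'V^{-1}(y-X\tilde\beta)/(n-p)$; $H$ is a known $q\times p$ matrix of full row rank $q<p$, $h\in\mathbb R^q$ is known, $V_1=(HC^{-1}H')^{-1}$; $\hat\beta=\tilde\beta-C^{-1}H'V_1(H\tilde\beta-h)$ (restricted estimator); $\mathcal L_n=(H\tilde\beta-h)'V_1(H\tilde\beta-h)/(qS^2)$. $I(\cdot)$ is the indicator function. *)

theory Defs
  imports "HOL-Probability.Probability"
begin

definition pos_def_matrix :: "real^'n^'n \<Rightarrow> bool" where
  "pos_def_matrix A \<longleftrightarrow> transpose A = A \<and> (\<forall>x. x \<noteq> 0 \<longrightarrow> 0 < x \<bullet> (A *v x))"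

definition mvn_density :: "real^'n \<Rightarrow> real^'n^'n \<Rightarrow> real^'n \<Rightarrow> real" where
  "mvn_density a \<Sigma> x =
     exp (- ((x - a) \<bullet> (matrix_inv \<Sigma> *v (x - a))) / 2) / sqrt ((2 * pi) ^ CARD('n) * det \<Sigma>)"

definition elliptical_density ::
  "real \<Rightarrow> real^'n^'n \<Rightarrow> (real \<Rightarrow> real) \<Rightarrow> real^'n \<Rightarrow> real" where
  "elliptical_density \<sigma> V g x =
     g ((x \<bullet> (matrix_inv V *v x)) / \<sigma>\<^sup>2) / sqrt (det (\<sigma>\<^sup>2 *\<^sub>R V))"

text \<open>A finite signed measure on the measurable space of \<open>S\<close> is a real-valued set function
  \<open>\<mu>\<close>; its positive and negative parts are finite measures carried by disjoint sets.
  Only the measurable sets of \<open>S\<close> matter, not its values as a measure.\<close>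

definition jordan_decomposition ::
  "'a measure \<Rightarrow> ('a set \<Rightarrow> real) \<Rightarrow> 'a measure \<Rightarrow> 'a measure \<Rightarrow> bool" where
  "jordan_decomposition S \<mu> \<mu>p \<mu>n \<longleftrightarrow>
     finite_measure \<mu>p \<and> finite_measure \<mu>n \<and> sets \<mu>p = sets S \<and> sets \<mu>n = sets S \<and>
     (\<forall>A\<in>sets S. \<mu> A = measure \<mu>p A - measure \<mu>n A) \<and>
     (\<exists>P\<in>sets S. emeasure \<mu>n P = 0 \<and> emeasure \<mu>p (space S - P) = 0)"

text \<open>\<open>\<mu>\<close> is a signed mixing measure on \<open>(0,\<infinity>)\<close> with total mass 1 and
  \<open>\<integral> t\<^sup>-\<^sup>1 d\<mu>\<^sup>\<plusminus> < \<infinity>\<close>.\<close>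

definition mixing_measure ::
  "(real set \<Rightarrow> real) \<Rightarrow> real measure \<Rightarrow> real measure \<Rightarrow> bool" where
  "mixing_measure \<mu> \<mu>p \<mu>n \<longleftrightarrow>
     jordan_decomposition (restrict_space borel {0<..}) \<mu> \<mu>p \<mu>n \<and> \<mu> {0<..} = 1 \<and>
     integrable \<mu>p (\<lambda>t. 1 / t) \<and> integrable \<mu>n (\<lambda>t. 1 / t)"

text \<open>The mixture identity is required at \<open>x \<noteq> 0\<close> only: there the integrand is bounded
  in \<open>t\<close>, so both integrals converge, whereas at the null point \<open>x = 0\<close> they may diverge
  under the given moment condition.\<close>

definition elliptical_mixture ::
  "real \<Rightarrow> real^'n^'n \<Rightarrow> (real \<Rightarrow> real) \<Rightarrow> real measure \<Rightarrow> real measure \<Rightarrow> bool" where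
  "elliptical_mixture \<sigma> V g \<mu>p \<mu>n \<longleftrightarrow>
     (\<forall>x. x \<noteq> 0 \<longrightarrow> elliptical_density \<sigma> V g x =
        (\<integral>t. mvn_density 0 ((\<sigma>\<^sup>2 / t) *\<^sub>R V) x \<partial>\<mu>p) -
        (\<integral>t. mvn_density 0 ((\<sigma>\<^sup>2 / t) *\<^sub>R V) x \<partial>\<mu>n))"

definition gram :: "real^'p^'n \<Rightarrow> real^'n^'n \<Rightarrow> real^'p^'p" where
  "gram X V = transpose X ** matrix_inv V ** X"

definition gls :: "real^'p^'n \<Rightarrow> real^'n^'n \<Rightarrow> real^'n \<Rightarrow> real^'p" where
  "gls X V y = matrix_inv (gram X V) *v (transpose X *v (matrix_inv V *v y))"

definition S2 :: "real^'p^'n \<Rightarrow> real^'n^'n \<Rightarrow> real^'n \<Rightarrow> real" where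
  "S2 X V y =
     ((y - X *v gls X V y) \<bullet> (matrix_inv V *v (y - X *v gls X V y))) /
     (real CARD('n) - real CARD('p))"

definition V1 :: "real^'p^'n \<Rightarrow> real^'n^'n \<Rightarrow> real^'p^'q \<Rightarrow> real^'q^'q" where
  "V1 X V H = matrix_inv (H ** matrix_inv (gram X V) ** transpose H)"

definition restricted ::
  "real^'p^'n \<Rightarrow> real^'n^'n \<Rightarrow> real^'p^'q \<Rightarrow> real^'q \<Rightarrow> real^'n \<Rightarrow> real^'p" where
  "restricted X V H h y =
     gls X V y - (matrix_inv (gram X V) ** transpose H ** V1 X V H) *v (H *v gls X V y - h)"

definition test_stat ::
  "real^'p^'n \<Rightarrow> real^'n^'n \<Rightarrow> real^'p^'q \<Rightarrow> real^'q \<Rightarrow> real^'n \<Rightarrow> real" where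
  "test_stat X V H h y =
     ((H *v gls X V y - h) \<bullet> (V1 X V H *v (H *v gls X V y - h))) / (real CARD('q) * S2 X V y)"

definition shrink_const :: "real \<Rightarrow> real \<Rightarrow> real" where
  "shrink_const q m = ((q - 2) * m) / (q * (m + 2))"

definition stein ::
  "real \<Rightarrow> real^'p^'n \<Rightarrow> real^'n^'n \<Rightarrow> real^'p^'q \<Rightarrow> real^'q \<Rightarrow> real^'n \<Rightarrow> real^'p" where
  "stein d X V H h y =
     gls X V y - (d * inverse (test_stat X V H h y)) *\<^sub>R (gls X V y - restricted X V H h y)"

definition stein_plus ::
  "real \<Rightarrow> real^'p^'n \<Rightarrow> real^'n^'n \<Rightarrow> real^'p^'q \<Rightarrow> real^'q \<Rightarrow> real^'n \<Rightarrow> real^'p" where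
  "stein_plus d X V H h y =
     restricted X V H h y +
     ((1 - d * inverse (test_stat X V H h y)) * indicator {d<..} (test_stat X V H h y)) *\<^sub>R
       (gls X V y - restricted X V H h y)"

text \<open>Expected quadratic loss; as the loss is nonnegative, the expectation is taken in
  \<open>[0,\<infinity>]\<close>, so no junk value arises for an estimator without second moments.\<close>

definition quad_risk ::
  "'w measure \<Rightarrow> real^'p^'p \<Rightarrow> ('w \<Rightarrow> real^'p) \<Rightarrow> real^'p \<Rightarrow> ennreal" where
  "quad_risk M W b \<beta> = (\<integral>\<^sup>+\<omega>. ennreal ((b \<omega> - \<beta>) \<bullet> (W *v (b \<omega> - \<beta>))) \<partial>M)"

end

theory Submission
  imports Defs
begin

text \<open>In the inner product \<open>x \<bullet> V\<^sup>-\<^sup>1 y\<close> the error space splits orthogonally into the part \<open>u\<close> of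
  the column space of \<open>X\<close> compatible with the restriction, the part \<open>v\<close> seen by \<open>H\<close>, and
  the residual \<open>w\<close>. The two estimators differ only where \<open>k = (d / L\<^sub>n - 1)\<^sup>+\<close>, a function of
  \<open>|w| / |v|\<close>, is positive, and there the losses are the squared sizes of \<open>u - \<eta> - k v\<close> and
  \<open>u - \<eta>\<close>, where \<open>\<eta>\<close> is the centre of \<open>v\<close>. The sign change of \<open>u\<close> removes
  the cross terms with \<open>u\<close>, and reflecting \<open>v\<close> about \<open>\<eta>\<close> leaves the claim that \<open>k\<close> and
  \<open>v \<bullet> \<eta>\<close> have a nonnegative product moment. Comparing \<open>v\<close> with \<open>- v\<close>, this holds since
  \<open>\<integral> K(t\<^sup>2) g(s\<^sup>2 + t\<^sup>2 + c) ds dt\<close> decreases in \<open>c\<close> for increasing \<open>K\<close>, where \<open>s\<close> and \<open>t\<close> are one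
  coordinate of \<open>u\<close> and one of \<open>w\<close>.
  All integrals are taken in \<open>[0,\<infinity>]\<close>, so that no integrability has to be established.\<close>

section \<open>Lebesgue integrals and symmetries\<close>

lemma nn_integral_lborel_translate:
  fixes f :: "'a::euclidean_space \<Rightarrow> ennreal"
  assumes [measurable]: "f \<in> borel_measurable borel"
  shows "(\<integral>\<^sup>+x. f (x + c) \<partial>lborel) = (\<integral>\<^sup>+x. f x \<partial>lborel)"
  by (subst (2) lborel_distr_plus[of c, symmetric], subst nn_integral_distr)
     (simp_all add: add.commute)

lemma nn_integral_lborel_reflect:
  fixes f :: "'a::euclidean_space \<Rightarrow> ennreal"
  assumes [measurable]: "f \<in> borel_measurable borel"
  shows "(\<integral>\<^sup>+x. f (c - x) \<partial>lborel) = (\<integral>\<^sup>+x. f x \<partial>lborel)"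
proof -
  have "lborel = distr lborel borel (\<lambda>x::'a. c - x)"
    using lborel_affine[of "-1" c] by (simp add: density_1)
  then have "(\<integral>\<^sup>+x. f x \<partial>lborel) = (\<integral>\<^sup>+x. f x \<partial>distr lborel borel (\<lambda>x. c - x))" by simp
  also have "\<dots> = (\<integral>\<^sup>+x. f (c - x) \<partial>lborel)" by (rule nn_integral_distr) measurable
  finally show ?thesis by simp
qed

text \<open>As in the proof of uniqueness of Haar measure, both integrals are compared through
  an even \<open>R\<close>-invariant function of finite positive integral.\<close>

lemma nn_integral_linear_involution:
  fixes f :: "'a::euclidean_space \<Rightarrow> ennreal"
  assumes R: "linear R" "\<And>x. R (R x) = x" and [measurable]: "f \<in> borel_measurable borel"
  shows "(\<integral>\<^sup>+x. f (R x) \<partial>lborel) = (\<integral>\<^sup>+x. f x \<partial>lborel)"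
proof -
  have contR: "continuous_on UNIV R"
    using R(1) by (simp add: linear_continuous_on linear_linear)
  have [measurable]: "R \<in> borel_measurable borel"
    by (rule borel_measurable_continuous_onI[OF contR])
  \<comment> \<open>\<open>R\<close> need not be an isometry, so the unit ball is intersected with
    its preimage under \<open>R\<close>; since \<open>R\<close> is an involution, the intersection
    is invariant.\<close>
  define U where "U = {x. norm x < 1 \<and> norm (R x) < 1}"
  define \<psi> :: "'a \<Rightarrow> ennreal" where "\<psi> = indicator U"
  have "open U"
    unfolding U_def by (intro open_Collect_conj open_Collect_less continuous_intros contR)
  have "0 \<in> U" by (simp add: U_def linear_0[OF R(1)])
  have "bounded U" unfolding U_def bounded_iff by (auto intro: exI[of _ 1])
  have [measurable]: "U \<in> sets borel" using \<open>open U\<close> by simp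
  have [measurable]: "\<psi> \<in> borel_measurable borel" by (simp add: \<psi>_def)
  have \<psi>R: "\<psi> (R x) = \<psi> x" and \<psi>m: "\<psi> (- x) = \<psi> x" for x
    by (auto simp: \<psi>_def U_def R linear_neg[OF R(1)] split: split_indicator)
  have I: "(\<integral>\<^sup>+x. \<psi> x \<partial>lborel) = emeasure lborel U" by (simp add: \<psi>_def)
  have fin: "emeasure lborel U \<noteq> \<infinity>" using emeasure_bounded_finite[OF \<open>bounded U\<close>] by auto
  have pos: "emeasure lborel U \<noteq> 0"
  proof
    assume "emeasure lborel U = 0"
    then have "negligible U"
      by (metis \<open>U \<in> sets borel\<close> null_sets_completionI negligible_iff_null_sets null_setsI sets_lborel)
    then show False using open_not_negligible[OF \<open>open U\<close>] \<open>0 \<in> U\<close> by blast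
  qed
  have "(\<integral>\<^sup>+x. f (R x) \<partial>lborel) * (\<integral>\<^sup>+y. \<psi> y \<partial>lborel) = (\<integral>\<^sup>+y. (\<integral>\<^sup>+x. f (R x) \<partial>lborel) * \<psi> y \<partial>lborel)"
    by (simp add: nn_integral_cmult)
  also have "\<dots> = (\<integral>\<^sup>+y. (\<integral>\<^sup>+x. f (R x + y) * \<psi> y \<partial>lborel) \<partial>lborel)"
  proof (rule nn_integral_cong)
    fix y
    \<comment> \<open>Translating by \<open>R y\<close> inside \<open>R\<close> amounts to
      translating by \<open>y\<close> outside, because \<open>R (R y) = y\<close>.\<close>
    have "(\<integral>\<^sup>+x. f (R x) \<partial>lborel) = (\<integral>\<^sup>+x. f (R (x + R y)) \<partial>lborel)"
      by (rule nn_integral_lborel_translate[symmetric]) measurable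
    then show "(\<integral>\<^sup>+x. f (R x) \<partial>lborel) * \<psi> y = (\<integral>\<^sup>+x. f (R x + y) * \<psi> y \<partial>lborel)"
      by (simp add: linear_add[OF R(1)] R(2) nn_integral_multc)
  qed
  also have "\<dots> = (\<integral>\<^sup>+x. (\<integral>\<^sup>+y. f (y + R x) * \<psi> y \<partial>lborel) \<partial>lborel)"
    by (subst lborel_pair.Fubini') (auto simp: add.commute)
  also have "\<dots> = (\<integral>\<^sup>+x. (\<integral>\<^sup>+y. f y * \<psi> (y - R x) \<partial>lborel) \<partial>lborel)"
  proof (rule nn_integral_cong)
    fix x
    show "(\<integral>\<^sup>+y. f (y + R x) * \<psi> y \<partial>lborel) = (\<integral>\<^sup>+y. f y * \<psi> (y - R x) \<partial>lborel)"
      using nn_integral_lborel_translate[of "\<lambda>y. f y * \<psi> (y - R x)" "R x"] by simp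
  qed
  also have "\<dots> = (\<integral>\<^sup>+y. (\<integral>\<^sup>+x. f y * \<psi> (y - R x) \<partial>lborel) \<partial>lborel)"
    by (rule lborel_pair.Fubini') auto
  also have "\<dots> = (\<integral>\<^sup>+y. f y * (\<integral>\<^sup>+x. \<psi> x \<partial>lborel) \<partial>lborel)"
  proof (rule nn_integral_cong)
    fix y
    \<comment> \<open>Invariance of \<psi> frees \<open>x\<close> from \<open>R\<close>; a
      reflection then makes the inner integral independent of \<open>y\<close>.\<close>
    have "\<psi> (y - R x) = \<psi> (R y - x)" for x
      by (metis \<psi>R R linear_diff)
    then have "(\<integral>\<^sup>+x. \<psi> (y - R x) \<partial>lborel) = (\<integral>\<^sup>+x. \<psi> x \<partial>lborel)"
      by (simp add: nn_integral_lborel_reflect)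
    then show "(\<integral>\<^sup>+x. f y * \<psi> (y - R x) \<partial>lborel) = f y * (\<integral>\<^sup>+x. \<psi> x \<partial>lborel)"
      by (simp add: nn_integral_cmult)
  qed
  also have "\<dots> = (\<integral>\<^sup>+x. f x \<partial>lborel) * (\<integral>\<^sup>+y. \<psi> y \<partial>lborel)"
    by (simp add: nn_integral_multc)
  finally show ?thesis
    using pos fin unfolding I
    by (simp add: mult.commute[of _ "emeasure lborel U"] ennreal_mult_cancel_left)
qed

text \<open>The substitution \<open>z = t^2\<close> is made on compact intervals and carried to the
  half line by monotone convergence. The cutoffs are squares so that they pull back to
  \<open>{0..N}\<close>.\<close>

lemma nn_integral_half_line_square:
  fixes f :: "real \<Rightarrow> ennreal"
  assumes [measurable]: "f \<in> borel_measurable borel"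
  shows "(\<integral>\<^sup>+z. f z * indicator {0..} z \<partial>lborel) =
    (\<integral>\<^sup>+t. f (t\<^sup>2) * ennreal (2 * t) * indicator {0..} t \<partial>lborel)"
proof -
  have sq: "incseq (\<lambda>N z. f z * indicator {0..(real N)\<^sup>2} z)"
    by (auto simp: incseq_def le_fun_def split: split_indicator intro!: mult_left_mono)
       (meson of_nat_0_le_iff of_nat_le_iff order_trans power_mono)
  have "(\<integral>\<^sup>+z. f z * indicator {0..} z \<partial>lborel) = (\<integral>\<^sup>+z. (SUP N. f z * indicator {0..(real N)\<^sup>2} z) \<partial>lborel)"
  proof (rule nn_integral_cong)
    fix z :: real
    obtain N where N: "z \<le> real N" using real_arch_simple by blast
    have "N \<le> N\<^sup>2" by (simp add: power2_eq_square)
    then have "real N \<le> (real N)\<^sup>2" by (metis of_nat_le_iff of_nat_power)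
    with N have "z \<le> (real N)\<^sup>2" by linarith
    then have "f z * indicator {0..} z \<le> f z * indicator {0..(real N)\<^sup>2} z"
      by (auto split: split_indicator)
    also have "\<dots> \<le> (SUP N. f z * indicator {0..(real N)\<^sup>2} z)" by (rule SUP_upper) simp
    finally show "f z * indicator {0..} z = (SUP N. f z * indicator {0..(real N)\<^sup>2} z)"
      by (intro antisym SUP_least) (auto split: split_indicator)
  qed
  also have "\<dots> = (SUP N. \<integral>\<^sup>+z. f z * indicator {0..(real N)\<^sup>2} z \<partial>lborel)"
    by (rule nn_integral_monotone_convergence_SUP[OF sq]) measurable
  also have "\<dots> = (SUP N. \<integral>\<^sup>+t. f (t\<^sup>2) * ennreal (2 * t) * indicator {0..real N} t \<partial>lborel)"
  proof (rule SUP_cong[OF refl])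
    fix N :: nat
    show "(\<integral>\<^sup>+z. f z * indicator {0..(real N)\<^sup>2} z \<partial>lborel) =
      (\<integral>\<^sup>+t. f (t\<^sup>2) * ennreal (2 * t) * indicator {0..real N} t \<partial>lborel)"
    \<comment> \<open>Substitution needs a nondegenerate interval; for \<open>N = 0\<close> both
      integrals are over a single point.\<close>
    proof (cases "N = 0")
      case True
      then show ?thesis by (simp add: nn_integral_indicator_singleton)
    next
      case False
      have "(\<integral>\<^sup>+z. f z * indicator {0\<^sup>2..(real N)\<^sup>2} z \<partial>lborel) =
        (\<integral>\<^sup>+t. f (t\<^sup>2) * ennreal (2 * t) * indicator {0..real N} t \<partial>lborel)"
        by (rule nn_integral_substitution_aux)
           (use False in \<open>auto intro!: derivative_eq_intros continuous_intros\<close>)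
      then show ?thesis by simp
    qed
  qed
  also have "\<dots> = (\<integral>\<^sup>+t. (SUP N. f (t\<^sup>2) * ennreal (2 * t) * indicator {0..real N} t) \<partial>lborel)"
    by (rule nn_integral_monotone_convergence_SUP[symmetric])
       (auto simp: incseq_def le_fun_def split: split_indicator)
  also have "\<dots> = (\<integral>\<^sup>+t. f (t\<^sup>2) * ennreal (2 * t) * indicator {0..} t \<partial>lborel)"
  proof (rule nn_integral_cong)
    fix t :: real
    obtain N where N: "t \<le> real N" using real_arch_simple by blast
    then have "f (t\<^sup>2) * ennreal (2 * t) * indicator {0..} t \<le> f (t\<^sup>2) * ennreal (2 * t) * indicator {0..real N} t"
      by (auto split: split_indicator)
    also have "\<dots> \<le> (SUP N. f (t\<^sup>2) * ennreal (2 * t) * indicator {0..real N} t)" by (rule SUP_upper) simp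
    finally show "(SUP N. f (t\<^sup>2) * ennreal (2 * t) * indicator {0..real N} t) = f (t\<^sup>2) * ennreal (2 * t) * indicator {0..} t"
      by (intro antisym SUP_least) (auto split: split_indicator)
  qed
  finally show ?thesis .
qed

text \<open>Raising \<open>c\<close> to \<open>c'\<close> has the effect of translating
  \<open>z\<close> by \<open>(c' - c) / a\<close> in the argument of \<open>G\<close>. The
  translation only increases \<open>K\<close> and keeps the half line inside itself.\<close>

lemma nn_integral_half_line_shift_le:
  fixes K G :: "real \<Rightarrow> ennreal"
  assumes [measurable]: "K \<in> borel_measurable borel" "G \<in> borel_measurable borel"
    and K: "\<And>s t. 0 \<le> s \<Longrightarrow> s \<le> t \<Longrightarrow> K s \<le> K t" and "0 < a" "c \<le> c'"
  shows "(\<integral>\<^sup>+z. K z * G (a * z + c') * indicator {0..} z \<partial>lborel)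
    \<le> (\<integral>\<^sup>+z. K z * G (a * z + c) * indicator {0..} z \<partial>lborel)"
proof -
  define \<delta> where "\<delta> = (c' - c) / a"
  have \<delta>: "0 \<le> \<delta>" "a * \<delta> = c' - c" using assms by (auto simp: \<delta>_def)
  have "(\<integral>\<^sup>+z. K z * G (a * z + c') * indicator {0..} z \<partial>lborel)
    \<le> (\<integral>\<^sup>+z. K (z + \<delta>) * G (a * (z + \<delta>) + c) * indicator {0..} (z + \<delta>) \<partial>lborel)"
    using \<delta> by (intro nn_integral_mono)
      (auto simp: distrib_left split: split_indicator intro!: mult_right_mono K)
  also have "\<dots> = (\<integral>\<^sup>+z. K z * G (a * z + c) * indicator {0..} z \<partial>lborel)"
    by (rule nn_integral_lborel_translate) measurable
  finally show ?thesis .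
qed

lemma nn_integral_even:
  fixes f :: "real \<Rightarrow> ennreal"
  assumes [measurable]: "f \<in> borel_measurable borel" and even: "\<And>t. f (- t) = f t"
  shows "(\<integral>\<^sup>+t. f t \<partial>lborel) = 2 * (\<integral>\<^sup>+t. f t * indicator {0..} t \<partial>lborel)"
proof -
  have "(\<integral>\<^sup>+t. f t \<partial>lborel) = (\<integral>\<^sup>+t. f t * indicator {0..} t + f t * indicator {..0} t \<partial>lborel)"
    by (rule nn_integral_cong_AE, rule AE_mp[OF AE_lborel_singleton[of 0]])
       (auto split: split_indicator)
  also have "\<dots> = (\<integral>\<^sup>+t. f t * indicator {0..} t \<partial>lborel) + (\<integral>\<^sup>+t. f t * indicator {..0} t \<partial>lborel)"
    by (rule nn_integral_add) auto
  also have "(\<integral>\<^sup>+t. f t * indicator {..0} t \<partial>lborel) = (\<integral>\<^sup>+t. f (0 - t) * indicator {..0} (0 - t) \<partial>lborel)"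
    by (rule nn_integral_lborel_reflect[symmetric]) measurable
  also have "\<dots> = (\<integral>\<^sup>+t. f t * indicator {0..} t \<partial>lborel)"
    by (intro nn_integral_cong) (auto simp: even split: split_indicator)
  finally show ?thesis by (simp add: mult_2)
qed

text \<open>After \<open>s = t r\<close> and \<open>z = t\<^sup>2\<close> the Jacobian factor cancels, so that only monotonicity
  of \<open>K\<close> matters and \<open>G\<close> may be arbitrary; on a line instead of a plane a factor
  \<open>1 / t\<close> would remain and the claim would fail.\<close>

lemma nn_integral_plane_shift_le:
  fixes K G :: "real \<Rightarrow> ennreal"
  assumes [measurable]: "K \<in> borel_measurable borel" "G \<in> borel_measurable borel"
    and K: "\<And>s t. 0 \<le> s \<Longrightarrow> s \<le> t \<Longrightarrow> K s \<le> K t" and "c \<le> c'"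
  shows "(\<integral>\<^sup>+s. \<integral>\<^sup>+t. K (t\<^sup>2) * G (s\<^sup>2 + t\<^sup>2 + c') \<partial>lborel \<partial>lborel)
    \<le> (\<integral>\<^sup>+s. \<integral>\<^sup>+t. K (t\<^sup>2) * G (s\<^sup>2 + t\<^sup>2 + c) \<partial>lborel \<partial>lborel)"
proof -
  have *: "(\<integral>\<^sup>+s. \<integral>\<^sup>+t. K (t\<^sup>2) * G (s\<^sup>2 + t\<^sup>2 + b) \<partial>lborel \<partial>lborel) =
     (\<integral>\<^sup>+r. \<integral>\<^sup>+z. K z * G ((1 + r\<^sup>2) * z + b) * indicator {0..} z \<partial>lborel \<partial>lborel)" for b
  proof -
    have "(\<integral>\<^sup>+s. \<integral>\<^sup>+t. K (t\<^sup>2) * G (s\<^sup>2 + t\<^sup>2 + b) \<partial>lborel \<partial>lborel)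
      = (\<integral>\<^sup>+t. \<integral>\<^sup>+s. K (t\<^sup>2) * G (s\<^sup>2 + t\<^sup>2 + b) \<partial>lborel \<partial>lborel)"
      by (rule lborel_pair.Fubini') auto
    also have "\<dots> = (\<integral>\<^sup>+t. \<integral>\<^sup>+r. K (t\<^sup>2) * G ((1 + r\<^sup>2) * t\<^sup>2 + b) * ennreal \<bar>t\<bar> \<partial>lborel \<partial>lborel)"
    proof (rule nn_integral_cong_AE, rule AE_mp[OF AE_lborel_singleton[of 0]], intro AE_I2 impI)
      fix t :: real assume "t \<noteq> 0"
      then have "(\<integral>\<^sup>+s. K (t\<^sup>2) * G (s\<^sup>2 + t\<^sup>2 + b) \<partial>lborel) =
          ennreal \<bar>t\<bar> * (\<integral>\<^sup>+r. K (t\<^sup>2) * G ((0 + t * r)\<^sup>2 + t\<^sup>2 + b) \<partial>lborel)"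
        by (intro nn_integral_real_affine) auto
      also have "\<dots> = (\<integral>\<^sup>+r. ennreal \<bar>t\<bar> * (K (t\<^sup>2) * G ((0 + t * r)\<^sup>2 + t\<^sup>2 + b)) \<partial>lborel)"
        by (rule nn_integral_cmult[symmetric]) measurable
      finally show "(\<integral>\<^sup>+s. K (t\<^sup>2) * G (s\<^sup>2 + t\<^sup>2 + b) \<partial>lborel) =
          (\<integral>\<^sup>+r. K (t\<^sup>2) * G ((1 + r\<^sup>2) * t\<^sup>2 + b) * ennreal \<bar>t\<bar> \<partial>lborel)"
        by (simp add: power_mult_distrib algebra_simps)
    qed
    also have "\<dots> = (\<integral>\<^sup>+r. \<integral>\<^sup>+t. K (t\<^sup>2) * G ((1 + r\<^sup>2) * t\<^sup>2 + b) * ennreal \<bar>t\<bar> \<partial>lborel \<partial>lborel)"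
      by (rule lborel_pair.Fubini') auto
    also have "\<dots> = (\<integral>\<^sup>+r. \<integral>\<^sup>+z. K z * G ((1 + r\<^sup>2) * z + b) * indicator {0..} z \<partial>lborel \<partial>lborel)"
    proof (rule nn_integral_cong)
      fix r :: real
      \<comment> \<open>Folding the even integrand onto the half line gives a factor 2, which joins
        the Jacobian \<open>t\<close> of \<open>s = t r\<close> to form the \<open>2 t\<close> of
        \<open>z = t^2\<close>.\<close>
      have "(\<integral>\<^sup>+t. K (t\<^sup>2) * G ((1 + r\<^sup>2) * t\<^sup>2 + b) * ennreal \<bar>t\<bar> \<partial>lborel)
         = 2 * (\<integral>\<^sup>+t. K (t\<^sup>2) * G ((1 + r\<^sup>2) * t\<^sup>2 + b) * ennreal \<bar>t\<bar> * indicator {0..} t \<partial>lborel)"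
        by (rule nn_integral_even) auto
      also have "\<dots> = (\<integral>\<^sup>+t. 2 * (K (t\<^sup>2) * G ((1 + r\<^sup>2) * t\<^sup>2 + b) * ennreal \<bar>t\<bar> * indicator {0..} t) \<partial>lborel)"
        by (rule nn_integral_cmult[symmetric]) measurable
      also have "\<dots> = (\<integral>\<^sup>+t. K (t\<^sup>2) * G ((1 + r\<^sup>2) * t\<^sup>2 + b) * ennreal (2 * t) * indicator {0..} t \<partial>lborel)"
        by (intro nn_integral_cong) (auto simp: ennreal_mult algebra_simps split: split_indicator)
      also have "\<dots> = (\<integral>\<^sup>+z. K z * G ((1 + r\<^sup>2) * z + b) * indicator {0..} z \<partial>lborel)"
        by (rule nn_integral_half_line_square[symmetric]) measurable
      finally show "(\<integral>\<^sup>+t. K (t\<^sup>2) * G ((1 + r\<^sup>2) * t\<^sup>2 + b) * ennreal \<bar>t\<bar> \<partial>lborel) =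
         (\<integral>\<^sup>+z. K z * G ((1 + r\<^sup>2) * z + b) * indicator {0..} z \<partial>lborel)" .
    qed
    finally show ?thesis .
  qed
  show ?thesis
    unfolding *
    by (intro nn_integral_mono nn_integral_half_line_shift_le K assms) 
       (auto simp: add_pos_nonneg)
qed

text \<open>Averaging over \<open>R\<close> preserves integrals, so integrands need comparing only
  after the terms odd under \<open>R\<close> have cancelled.\<close>

lemma nn_integral_involution_mono:
  fixes f g :: "'a::euclidean_space \<Rightarrow> ennreal"
  assumes R: "linear R" "\<And>x. R (R x) = x"
    and [measurable]: "f \<in> borel_measurable borel" "g \<in> borel_measurable borel"
    and le: "\<And>x. f x + f (R x) \<le> g x + g (R x)"
  shows "(\<integral>\<^sup>+x. f x \<partial>lborel) \<le> (\<integral>\<^sup>+x. g x \<partial>lborel)"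
proof -
  have [measurable]: "R \<in> borel_measurable borel"
    using R(1) by (intro borel_measurable_continuous_onI linear_continuous_on) (simp add: linear_linear)
  have *: "(\<integral>\<^sup>+x. F x + F (R x) \<partial>lborel) = 2 * (\<integral>\<^sup>+x. F x \<partial>lborel)"
    if [measurable]: "F \<in> borel_measurable borel" for F :: "'a \<Rightarrow> ennreal"
    by (subst nn_integral_add) (auto simp: nn_integral_linear_involution[OF R that] mult_2)
  have "2 * (\<integral>\<^sup>+x. f x \<partial>lborel) \<le> 2 * (\<integral>\<^sup>+x. g x \<partial>lborel)"
    using nn_integral_mono[OF le, of lborel "\<lambda>x. x"] by (simp add: *)
  then show ?thesis by (subst (asm) ennreal_mult_le_mult_iff) auto
qed

text \<open>Averaging over the unit square of translates in the plane of \<open>e\<close> and \<open>f\<close>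
  replaces an orthogonal change of coordinates.\<close>

lemma nn_integral_planar_slices_mono:
  fixes \<phi> \<psi> :: "'a::euclidean_space \<Rightarrow> ennreal" and \<alpha> \<gamma> :: "'a \<Rightarrow> real"
  assumes [measurable]: "\<phi> \<in> borel_measurable borel" "\<psi> \<in> borel_measurable borel"
    and lin: "bounded_linear \<alpha>" "bounded_linear \<gamma>"
    and dual: "\<alpha> e = 1" "\<alpha> f = 0" "\<gamma> e = 0" "\<gamma> f = (1::real)"
    and le: "\<And>x. \<alpha> x = 0 \<Longrightarrow> \<gamma> x = 0 \<Longrightarrow>
      (\<integral>\<^sup>+s. \<integral>\<^sup>+t. \<phi> (x + s *\<^sub>R e + t *\<^sub>R f) \<partial>lborel \<partial>lborel) \<le>
      (\<integral>\<^sup>+s. \<integral>\<^sup>+t. \<psi> (x + s *\<^sub>R e + t *\<^sub>R f) \<partial>lborel \<partial>lborel)"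
  shows "(\<integral>\<^sup>+x. \<phi> x \<partial>lborel) \<le> (\<integral>\<^sup>+x. \<psi> x \<partial>lborel)"
proof -
  interpret \<alpha>: bounded_linear \<alpha> by fact
  interpret \<gamma>: bounded_linear \<gamma> by fact
  have [measurable]: "\<alpha> \<in> borel_measurable borel" "\<gamma> \<in> borel_measurable borel"
    by (auto intro!: borel_measurable_continuous_onI linear_continuous_on lin)
  define \<omega> :: "'a \<Rightarrow> ennreal" where "\<omega> x = indicator {0..1} (\<alpha> x) * indicator {0..1} (\<gamma> x)" for x
  have [measurable]: "\<omega> \<in> borel_measurable borel" unfolding \<omega>_def by measurable
  have unit: "(\<integral>\<^sup>+s. indicator {0..1} (a - s) \<partial>lborel) = (1::ennreal)" for a :: real
    by (subst nn_integral_lborel_reflect) auto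
  have \<omega>1: "(\<integral>\<^sup>+s. \<integral>\<^sup>+t. \<omega> (x - (s *\<^sub>R e + t *\<^sub>R f)) \<partial>lborel \<partial>lborel) = 1" for x
    by (simp add: \<omega>_def \<alpha>.diff \<alpha>.add \<alpha>.scale \<gamma>.diff \<gamma>.add \<gamma>.scale dual nn_integral_cmult unit)
  \<comment> \<open>The double integral of translates of \<omega> equals 1. It is inserted as a
    factor, and a translation of \<open>x\<close> then moves the shift from \<omega> to
    \<open>F\<close>.\<close>
  have avg: "(\<integral>\<^sup>+x. F x \<partial>lborel) =
      (\<integral>\<^sup>+x. \<omega> x * (\<integral>\<^sup>+s. \<integral>\<^sup>+t. F (x + s *\<^sub>R e + t *\<^sub>R f) \<partial>lborel \<partial>lborel) \<partial>lborel)"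
    if [measurable]: "F \<in> borel_measurable borel" for F :: "'a \<Rightarrow> ennreal"
  proof -
    have "(\<integral>\<^sup>+x. F x \<partial>lborel) = (\<integral>\<^sup>+x. F x * (\<integral>\<^sup>+s. \<integral>\<^sup>+t. \<omega> (x - (s *\<^sub>R e + t *\<^sub>R f)) \<partial>lborel \<partial>lborel) \<partial>lborel)"
      by (simp add: \<omega>1)
    also have "\<dots> = (\<integral>\<^sup>+x. \<integral>\<^sup>+s. \<integral>\<^sup>+t. F x * \<omega> (x - (s *\<^sub>R e + t *\<^sub>R f)) \<partial>lborel \<partial>lborel \<partial>lborel)"
      by (simp add: nn_integral_cmult)
    also have "\<dots> = (\<integral>\<^sup>+s. \<integral>\<^sup>+x. \<integral>\<^sup>+t. F x * \<omega> (x - (s *\<^sub>R e + t *\<^sub>R f)) \<partial>lborel \<partial>lborel \<partial>lborel)"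
      by (rule lborel_pair.Fubini') measurable
    also have "\<dots> = (\<integral>\<^sup>+s. \<integral>\<^sup>+t. \<integral>\<^sup>+x. F x * \<omega> (x - (s *\<^sub>R e + t *\<^sub>R f)) \<partial>lborel \<partial>lborel \<partial>lborel)"
      by (rule nn_integral_cong, rule lborel_pair.Fubini') measurable
    also have "\<dots> = (\<integral>\<^sup>+s. \<integral>\<^sup>+t. \<integral>\<^sup>+x. F (x + s *\<^sub>R e + t *\<^sub>R f) * \<omega> x \<partial>lborel \<partial>lborel \<partial>lborel)"
    proof (rule nn_integral_cong, rule nn_integral_cong)
      fix s t :: real
      show "(\<integral>\<^sup>+x. F x * \<omega> (x - (s *\<^sub>R e + t *\<^sub>R f)) \<partial>lborel) = (\<integral>\<^sup>+x. F (x + s *\<^sub>R e + t *\<^sub>R f) * \<omega> x \<partial>lborel)"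
        using nn_integral_lborel_translate[of "\<lambda>x. F x * \<omega> (x - (s *\<^sub>R e + t *\<^sub>R f))" "s *\<^sub>R e + t *\<^sub>R f"]
        by (simp add: add.assoc)
    qed
    also have "\<dots> = (\<integral>\<^sup>+s. \<integral>\<^sup>+x. \<integral>\<^sup>+t. F (x + s *\<^sub>R e + t *\<^sub>R f) * \<omega> x \<partial>lborel \<partial>lborel \<partial>lborel)"
      by (rule nn_integral_cong, rule lborel_pair.Fubini') measurable
    also have "\<dots> = (\<integral>\<^sup>+x. \<integral>\<^sup>+s. \<integral>\<^sup>+t. F (x + s *\<^sub>R e + t *\<^sub>R f) * \<omega> x \<partial>lborel \<partial>lborel \<partial>lborel)"
      by (rule lborel_pair.Fubini') measurable
    also have "\<dots> = (\<integral>\<^sup>+x. \<omega> x * (\<integral>\<^sup>+s. \<integral>\<^sup>+t. F (x + s *\<^sub>R e + t *\<^sub>R f) \<partial>lborel \<partial>lborel) \<partial>lborel)"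
      by (simp add: nn_integral_cmult mult.commute)
    finally show ?thesis .
  qed
  \<comment> \<open>Translating \<open>s\<close> and \<open>t\<close> replaces \<open>x\<close> by
    the point of its plane where \<alpha> and \<gamma> vanish, the only place where
    \<open>le\<close> is given.\<close>
  have center: "(\<integral>\<^sup>+s. \<integral>\<^sup>+t. F (x + s *\<^sub>R e + t *\<^sub>R f) \<partial>lborel \<partial>lborel) =
      (\<integral>\<^sup>+s. \<integral>\<^sup>+t. F ((x - \<alpha> x *\<^sub>R e - \<gamma> x *\<^sub>R f) + s *\<^sub>R e + t *\<^sub>R f) \<partial>lborel \<partial>lborel)"
    if [measurable]: "F \<in> borel_measurable borel" for F :: "'a \<Rightarrow> ennreal" and x
  proof -
    let ?y = "x - \<alpha> x *\<^sub>R e - \<gamma> x *\<^sub>R f"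
    have "(\<integral>\<^sup>+s. \<integral>\<^sup>+t. F (?y + s *\<^sub>R e + t *\<^sub>R f) \<partial>lborel \<partial>lborel) =
       (\<integral>\<^sup>+s. \<integral>\<^sup>+t. F (?y + (s + \<alpha> x) *\<^sub>R e + t *\<^sub>R f) \<partial>lborel \<partial>lborel)"
      by (rule nn_integral_lborel_translate[symmetric]) measurable
    also have "\<dots> = (\<integral>\<^sup>+s. \<integral>\<^sup>+t. F (?y + (s + \<alpha> x) *\<^sub>R e + (t + \<gamma> x) *\<^sub>R f) \<partial>lborel \<partial>lborel)"
      by (rule nn_integral_cong, rule nn_integral_lborel_translate[symmetric]) measurable
    finally show ?thesis by (simp add: algebra_simps)
  qed
  have slice: "(\<integral>\<^sup>+s. \<integral>\<^sup>+t. \<phi> (x + s *\<^sub>R e + t *\<^sub>R f) \<partial>lborel \<partial>lborel) \<le>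
      (\<integral>\<^sup>+s. \<integral>\<^sup>+t. \<psi> (x + s *\<^sub>R e + t *\<^sub>R f) \<partial>lborel \<partial>lborel)" for x
    by (subst (1 2) center) (auto intro!: le simp: \<alpha>.diff \<alpha>.scale \<gamma>.diff \<gamma>.scale dual)
  show ?thesis
    unfolding avg[OF assms(1)] avg[OF assms(2)]
    by (rule nn_integral_mono, rule mult_left_mono[OF slice]) simp
qed

section \<open>Spherical densities and orthogonal projections\<close>

text \<open>The three components of the overview are \<open>u = Q x - P x\<close>,
  \<open>v = P x\<close> and \<open>w = x - Q x\<close>; \<open>QP\<close> nests the ranges, which
  makes them \<open>B\<close>-orthogonal. Reflections for \<open>B\<close> need not be Euclidean
  isometries, but as linear involutions they still preserve \<open>lborel\<close>.\<close>

locale orthogonal_projections = bounded_bilinear B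
  for B :: "'a::euclidean_space \<Rightarrow> 'a \<Rightarrow> real" +
  fixes P Q :: "'a \<Rightarrow> 'a"
  assumes sym: "B x y = B y x" and pos: "x \<noteq> 0 \<Longrightarrow> 0 < B x x"
    and lin_P: "bounded_linear P" and lin_Q: "bounded_linear Q"
    and PP: "P (P x) = P x" and QQ: "Q (Q x) = Q x" and QP: "Q (P x) = P x"
    and adj_P: "B (P x) y = B x (P y)" and adj_Q: "B (Q x) y = B x (Q y)"
begin

sublocale P: bounded_linear P by (rule lin_P)
sublocale Q: bounded_linear Q by (rule lin_Q)

lemma eqI: assumes "\<And>y. B x y = B x' y" shows "x = x'"
proof (rule ccontr)
  assume "x \<noteq> x'"
  then have "0 < B (x - x') (x - x')" by (intro pos) simp
  then show False by (simp add: diff_left assms)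
qed

lemma PQ: "P (Q x) = P x"
  by (rule eqI) (simp add: adj_P adj_Q QP)

lemma nonneg: "0 \<le> B x x"
  using pos[of x] by (cases "x = 0") (auto simp: zero_left)

lemma measurable_B [measurable (raw)]:
  "f \<in> borel_measurable M \<Longrightarrow> g \<in> borel_measurable M \<Longrightarrow> (\<lambda>x. B (f x) (g x)) \<in> borel_measurable M"
  by (rule borel_measurable_continuous_Pair) (auto intro!: continuous_on continuous_intros)

lemma measurable_P [measurable]: "P \<in> borel_measurable borel"
  and measurable_Q [measurable]: "Q \<in> borel_measurable borel"
  by (auto intro!: borel_measurable_continuous_onI linear_continuous_on lin_P lin_Q)

text \<open>The premise says that \<open>d\<close> is an orthogonal projection of \<open>y\<close>,
  so that \<open>y - 2 d\<close> is a reflection of \<open>y\<close>.\<close>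

lemma reflect_isometry: "B y d = B d d \<Longrightarrow> B (y - 2 *\<^sub>R d) (y - 2 *\<^sub>R d) = B y y"
  using sym[of y d] by (simp add: diff_left diff_right scaleR_left scaleR_right)

text \<open>The amount \<open>(d / L\<^sub>n - 1)\<^sup>+\<close> by which the Stein estimator overshoots, with
  \<open>\<kappa> = d q / m\<close>; it is 0 where \<open>P x = 0\<close>, by the convention \<open>x / 0 = 0\<close>.\<close>

definition excess :: "real \<Rightarrow> 'a \<Rightarrow> real" where
  "excess \<kappa> x = max 0 (\<kappa> * B (x - Q x) (x - Q x) / B (P x) (P x) - 1)"

lemma measurable_excess [measurable]: "excess \<kappa> \<in> borel_measurable borel"
  unfolding excess_def by measurable

lemma excess_nonneg: "0 \<le> excess \<kappa> x" by (simp add: excess_def)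

text \<open>On planes parallel to \<open>e\<close> and \<open>f\<close>, both \<open>P x\<close> and
  \<open>B x \<eta>\<close> are constant and the excess grows with the squared residual coordinate.
  The arguments of \<open>G\<close> on the two sides differ by a constant, of favourable sign where
  \<open>B x \<eta>\<close> is positive, so \<open>nn_integral_plane_shift_le\<close> applies to
  each plane.\<close>

lemma spherical_correlation:
  fixes G :: "real \<Rightarrow> ennreal"
  assumes e: "Q e = e" "P e = 0" "B e e = 1" and f: "Q f = 0" "B f f = 1"
    and \<eta>: "P \<eta> = \<eta>" and "0 \<le> \<kappa>" and [measurable]: "G \<in> borel_measurable borel"
  shows "(\<integral>\<^sup>+x. ennreal (excess \<kappa> x * max 0 (B x \<eta>)) * G (B (x + \<eta>) (x + \<eta>)) \<partial>lborel)
    \<le> (\<integral>\<^sup>+x. ennreal (excess \<kappa> x * max 0 (B x \<eta>)) * G (B (x - \<eta>) (x - \<eta>)) \<partial>lborel)"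
proof (rule nn_integral_planar_slices_mono[of _ _ "\<lambda>x. B x e" "\<lambda>x. B x f" e f])
  have Pf: "P f = 0" using PQ[of f] f by (simp add: P.zero)
  have ef: "B e f = 0" by (metis adj_Q e(1) f(1) zero_right)
  have e\<eta>: "B e \<eta> = 0" and f\<eta>: "B f \<eta> = 0"
    by (metis \<eta> adj_P e(2) zero_left, metis \<eta> adj_P Pf zero_left)
  show "B e e = 1" "B f e = 0" "B e f = 0" "B f f = 1" using e f ef sym[of e f] by auto
  fix x assume x: "B x e = 0" "B x f = 0"
  have wf: "B (x - Q x) f = 0" by (simp add: diff_left x adj_Q f zero_right)
  have *: "excess \<kappa> (x + s *\<^sub>R e + t *\<^sub>R f) = 
      max 0 (\<kappa> * (B (x - Q x) (x - Q x) + t\<^sup>2) / B (P x) (P x) - 1)" for s t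
  proof -
    have "x + s *\<^sub>R e + t *\<^sub>R f - Q (x + s *\<^sub>R e + t *\<^sub>R f) = (x - Q x) + t *\<^sub>R f"
      by (simp add: Q.add Q.scale e f)
    moreover have "P (x + s *\<^sub>R e + t *\<^sub>R f) = P x" by (simp add: P.add P.scale e Pf)
    moreover have "B ((x - Q x) + t *\<^sub>R f) ((x - Q x) + t *\<^sub>R f) = B (x - Q x) (x - Q x) + t\<^sup>2"
      by (simp add: add_left add_right scaleR_left scaleR_right wf sym[of f "x - Q x"] f power2_eq_square)
    ultimately show ?thesis by (simp only: excess_def)
  qed
  have **: "B (x + s *\<^sub>R e + t *\<^sub>R f) \<eta> = B x \<eta>" for s t
    by (simp add: add_left scaleR_left e\<eta> f\<eta>)
  have expand: "B (x + s *\<^sub>R e + t *\<^sub>R f + c *\<^sub>R \<eta>) (x + s *\<^sub>R e + t *\<^sub>R f + c *\<^sub>R \<eta>) =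
      s\<^sup>2 + t\<^sup>2 + B (x + c *\<^sub>R \<eta>) (x + c *\<^sub>R \<eta>)" for s t c
    by (simp add: add_left add_right scaleR_left scaleR_right x e f ef e\<eta> f\<eta>
        sym[of e x] sym[of f x] sym[of f e] sym[of \<eta> e] sym[of \<eta> f] power2_eq_square algebra_simps)
  define K where "K z = ennreal (max 0 (\<kappa> * (B (x - Q x) (x - Q x) + z) / B (P x) (P x) - 1) * max 0 (B x \<eta>))" for z
  have [measurable]: "K \<in> borel_measurable borel" unfolding K_def by measurable
  have K: "K z \<le> K z'" if "z \<le> z'" for z z'
    unfolding K_def using that assms nonneg[of "P x"]
    by (intro ennreal_leI mult_right_mono max.mono diff_right_mono divide_right_mono mult_left_mono) auto
  show "(\<integral>\<^sup>+s. \<integral>\<^sup>+t. ennreal (excess \<kappa> (x + s *\<^sub>R e + t *\<^sub>R f) * max 0 (B (x + s *\<^sub>R e + t *\<^sub>R f) \<eta>)) *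
          G (B (x + s *\<^sub>R e + t *\<^sub>R f + \<eta>) (x + s *\<^sub>R e + t *\<^sub>R f + \<eta>)) \<partial>lborel \<partial>lborel)
     \<le> (\<integral>\<^sup>+s. \<integral>\<^sup>+t. ennreal (excess \<kappa> (x + s *\<^sub>R e + t *\<^sub>R f) * max 0 (B (x + s *\<^sub>R e + t *\<^sub>R f) \<eta>)) *
          G (B (x + s *\<^sub>R e + t *\<^sub>R f - \<eta>) (x + s *\<^sub>R e + t *\<^sub>R f - \<eta>)) \<partial>lborel \<partial>lborel)"
  \<comment> \<open>Planes with \<open>B x \<eta>\<close> not positive contribute 0 to both
    sides.\<close>
  proof (cases "0 < B x \<eta>")
    case True
    then have "B (x - \<eta>) (x - \<eta>) \<le> B (x + \<eta>) (x + \<eta>)"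
      using sym[of x \<eta>] by (simp add: add_left add_right diff_left diff_right)
    from nn_integral_plane_shift_le[OF _ _ _ this, of K G] K expand[of _ _ 1] expand[of _ _ "-1"]
    show ?thesis by (simp add: * ** flip: K_def)
  qed (simp add: **)
qed (auto intro: bounded_linear_left)

text \<open>Here \<open>p\<close> is the coefficient of \<open>P x\<close> for the positive rule and
  \<open>p - excess\<close> that of the Stein rule. By \<open>pk\<close>, \<open>p\<close> vanishes
  wherever they differ. \<open>N\<close> is only semidefinite, since the loss ignores the
  residual.\<close>

lemma truncation_risk_le:
  fixes G :: "real \<Rightarrow> ennreal" and N :: "'a \<Rightarrow> 'a \<Rightarrow> real"
  assumes e: "Q e = e" "P e = 0" "B e e = 1" and f: "Q f = 0" "B f f = 1"
    and \<eta>: "P \<eta> = \<eta>" and \<kappa>: "0 \<le> \<kappa>" and G [measurable]: "G \<in> borel_measurable borel"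
    and N: "bounded_bilinear N" "\<And>x. 0 \<le> N x x"
    and [measurable]: "p \<in> borel_measurable borel" and pk: "\<And>x. p x * excess \<kappa> x = 0"
  defines "loss \<equiv> \<lambda>c x. ennreal (N (Q x - P x - \<eta> + c *\<^sub>R P x) (Q x - P x - \<eta> + c *\<^sub>R P x))"
  shows "(\<integral>\<^sup>+x. loss (p x) x * G (B (x - \<eta>) (x - \<eta>)) \<partial>lborel)
    \<le> (\<integral>\<^sup>+x. loss (p x - excess \<kappa> x) x * G (B (x - \<eta>) (x - \<eta>)) \<partial>lborel)"
proof -
  interpret N: bounded_bilinear N by (rule N(1))
  have [measurable (raw)]: "g \<in> borel_measurable M \<Longrightarrow> h \<in> borel_measurable M \<Longrightarrow> (\<lambda>x. N (g x) (h x)) \<in> borel_measurable M"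
    for g h :: "'b \<Rightarrow> 'a" and M
    by (rule borel_measurable_continuous_Pair) (auto intro!: N.continuous_on continuous_intros)
  define k where "k = excess \<kappa>"
  define u where "u x = Q x - P x" for x
  define F where "F x = G (B (x - \<eta>) (x - \<eta>))" for x
  \<comment> \<open>The density restricted to the region where the two losses can differ.\<close>
  define h where "h x = indicator {x. 0 < k x} x * F x" for x
  define q where "q x = ennreal (N x x)" for x
  have [measurable]: "k \<in> borel_measurable borel" unfolding k_def by measurable
  have [measurable]: "u \<in> borel_measurable borel" unfolding u_def by measurable
  have [measurable]: "F \<in> borel_measurable borel" unfolding F_def by measurable
  have [measurable]: "h \<in> borel_measurable borel" unfolding h_def by measurable
  have [measurable]: "q \<in> borel_measurable borel" unfolding q_def by measurable
  have k0: "0 \<le> k x" for x by (simp add: k_def excess_nonneg)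
  have N_par: "N (x + y) (x + y) + N (x - y) (x - y) = 2 * (N x x + N y y)" for x y
    by (simp add: N.add_left N.add_right N.diff_left N.diff_right)
  \<comment> \<open>The parallelogram law eliminates cross terms without any subtraction in
    \<open>[0,\<infinity>]\<close>.\<close>
  have q_par: "q (x + y) + q (x - y) = 2 * (q x + q y)" for x y
    unfolding q_def using N(2) N_par[of x y]
    by (simp add: ennreal_plus[symmetric] numeral_mult_ennreal del: ennreal_plus)
  have q_minus: "q (- x) = q x" for x by (simp add: q_def N.minus_left N.minus_right)
  have q_scale: "q (c *\<^sub>R x) = ennreal (c\<^sup>2) * q x" for c x
    by (simp add: q_def N.scaleR_left N.scaleR_right N(2) power2_eq_square mult.assoc flip: ennreal_mult')

  \<comment> \<open>\<open>R1\<close> negates the unrestricted part \<open>u\<close>, which removes the cross term; \<open>R2\<close> reflects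
    \<open>P x\<close> about the line of \<open>\<eta>\<close>; \<open>R3\<close> negates \<open>P x\<close> and thereby moves the centre of the
    density from \<open>\<eta>\<close> to \<open>- \<eta>\<close>.\<close>
  define R1 where "R1 x = x - 2 *\<^sub>R u x" for x
  have lin_u: "bounded_linear u"
    unfolding u_def by (intro bounded_linear_sub lin_P lin_Q)
  have R1_lin: "linear R1"
    unfolding R1_def by (intro linear_compose_sub linear_compose_scale_right linear_ident bounded_linear.linear[OF lin_u])
  have PR1: "P (R1 x) = P x" and QR1: "Q (R1 x) = 2 *\<^sub>R P x - Q x" for x
    by (simp_all add: R1_def u_def P.diff P.scale P.add Q.diff Q.scale Q.add PP PQ QP QQ algebra_simps scaleR_2)
  have uR1: "u (R1 x) = - u x" for x by (simp add: u_def PR1 QR1 scaleR_2)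
  have R1_inv: "R1 (R1 x) = x" for x by (simp add: R1_def[of "R1 x"] uR1) (simp add: R1_def)
  have kR1: "k (R1 x) = k x" for x
  proof -
    have "R1 x - Q (R1 x) = x - Q x" by (simp add: QR1) (simp add: R1_def u_def algebra_simps scaleR_2)
    then show ?thesis by (simp add: k_def excess_def PR1)
  qed
  \<comment> \<open>The centre \<eta> lies in the range of \<open>P\<close> and has no
    \<open>u\<close> part, so negating \<open>u\<close> fixes it.\<close>
  have FR1: "F (R1 x) = F x" for x
  proof -
    have u_adj: "B y (u x) = B (u y) x" for y x
      by (simp add: u_def diff_left diff_right adj_P adj_Q)
    have "u (u x) = u x" by (simp add: u_def P.diff Q.diff PP PQ QP QQ)
    then have "B x (u x) = B (u x) (u x)" by (metis u_adj)
    moreover have "u \<eta> = 0" by (metis \<eta> QP u_def diff_self)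
    ultimately have "B (x - \<eta>) (u x) = B (u x) (u x)" by (simp add: diff_left u_adj[of \<eta>] zero_left)
    then show ?thesis
      using reflect_isometry[of "x - \<eta>" "u x"] by (simp add: F_def R1_def algebra_simps)
  qed
  have hR1: "h (R1 x) = h x" for x by (simp add: h_def kR1 FR1 indicator_def)
  \<comment> \<open>Used with \<open>z = - \<eta>\<close> and \<open>z = - (\<eta> + k P x)\<close>;
    the integral of \<open>q (u x) * h x\<close> is then common to both risks, and comparing the
    other terms is \<open>main\<close>.\<close>
  have cross: "(\<integral>\<^sup>+x. q (u x + z x) * h x \<partial>lborel) = (\<integral>\<^sup>+x. q (u x) * h x \<partial>lborel) + (\<integral>\<^sup>+x. q (z x) * h x \<partial>lborel)"
    if z: "z \<in> borel_measurable borel" "\<And>x. z (R1 x) = z x" for z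
  proof -
    note [measurable] = z(1)
    have qq: "q (z x - u x) = q (u x - z x)" for x
      using q_minus[of "u x - z x"] by simp
    have eq: "q (u x + z x) * h x + q (u (R1 x) + z (R1 x)) * h (R1 x)
      = (q (u x) + q (z x)) * h x + (q (u (R1 x)) + q (z (R1 x))) * h (R1 x)" for x
    proof -
      have "q (u x + z x) * h x + q (u (R1 x) + z (R1 x)) * h (R1 x) = (q (u x + z x) + q (u x - z x)) * h x"
        by (simp add: uR1 z(2) hR1 qq distrib_right)
      also have "\<dots> = (q (u x) + q (z x)) * h x + (q (u x) + q (z x)) * h x"
        by (simp only: q_par mult_2 distrib_right)
      finally show ?thesis by (simp add: uR1 q_minus z(2) hR1)
    qed
    have "(\<integral>\<^sup>+x. q (u x + z x) * h x \<partial>lborel) = (\<integral>\<^sup>+x. (q (u x) + q (z x)) * h x \<partial>lborel)"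
      by (intro antisym nn_integral_involution_mono[OF R1_lin R1_inv]) (simp_all only: eq order_refl, measurable)
    also have "\<dots> = (\<integral>\<^sup>+x. q (u x) * h x \<partial>lborel) + (\<integral>\<^sup>+x. q (z x) * h x \<partial>lborel)"
      by (simp add: distrib_right nn_integral_add)
    finally show ?thesis .
  qed

  have main: "q \<eta> * (\<integral>\<^sup>+x. h x \<partial>lborel) \<le> (\<integral>\<^sup>+x. q (\<eta> + k x *\<^sub>R P x) * h x \<partial>lborel)"
  proof (cases "\<eta> = 0")
    case True
    then show ?thesis by (simp add: q_def N.zero_left)
  next
    case False
    then have B\<eta>: "0 < B \<eta> \<eta>" by (rule pos)
    \<comment> \<open>The coordinate of \<open>x\<close> along \<eta>; \<open>m\<close> below is the
      part of \<open>P x\<close> orthogonal to \<eta>.\<close>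
    define \<tau> where "\<tau> x = B x \<eta> / B \<eta> \<eta>" for x
    have [measurable]: "\<tau> \<in> borel_measurable borel" unfolding \<tau>_def by measurable
    have lin_\<tau>: "bounded_linear \<tau>"
      unfolding \<tau>_def using bounded_linear_left
      by (simp add: divide_inverse bounded_linear_mult_const)
    interpret \<tau>: bounded_linear \<tau> by (rule lin_\<tau>)
    have \<tau>P: "\<tau> (P x) = \<tau> x" and \<tau>\<eta>: "\<tau> \<eta> = 1" for x
      using B\<eta> by (simp_all add: \<tau>_def adj_P \<eta>)
    define m where "m x = P x - \<tau> x *\<^sub>R \<eta>" for x
    have lin_m: "linear m"
      unfolding m_def by (intro linear_compose_sub bounded_linear.linear[OF lin_P]
          bounded_linear.linear[OF bounded_linear_scaleR_const[OF lin_\<tau>]])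
    define R2 where "R2 x = x - 2 *\<^sub>R m x" for x
    have R2_lin: "linear R2"
      unfolding R2_def by (intro linear_compose_sub linear_compose_scale_right lin_m linear_ident)
    have PR2: "P (R2 x) = \<tau> x *\<^sub>R \<eta> + \<tau> x *\<^sub>R \<eta> - P x" for x
      by (simp only: R2_def m_def scaleR_2) (simp add: P.diff P.add P.scale PP \<eta>)
    have QR2: "Q (R2 x) = Q x - 2 *\<^sub>R m x" for x
      using QP[of \<eta>] by (simp add: R2_def m_def Q.diff Q.add Q.scale QP \<eta> algebra_simps)
    have \<tau>R2: "\<tau> (R2 x) = \<tau> x" for x
      by (simp add: R2_def m_def \<tau>.diff \<tau>.scale \<tau>P \<tau>\<eta>)
    have mR2: "m (R2 x) = - m x" for x
      by (simp add: m_def PR2 \<tau>R2)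
    have R2_inv: "R2 (R2 x) = x" for x by (simp add: R2_def[of "R2 x"] mR2) (simp add: R2_def)
    have B_m: "B x (m x) = B (m x) (m x)" "B \<eta> (m x) = 0" for x
    proof -
      have 1: "B x (P x) = B (P x) (P x)" by (metis PP adj_P)
      have 2: "B x \<eta> = \<tau> x * B \<eta> \<eta>" "B \<eta> x = \<tau> x * B \<eta> \<eta>" "B \<eta> (P x) = \<tau> x * B \<eta> \<eta>" "B (P x) \<eta> = \<tau> x * B \<eta> \<eta>"
        using B\<eta> sym[of x \<eta>] \<eta> adj_P[of \<eta> x] adj_P[of x \<eta>] by (auto simp: \<tau>_def)
      show "B x (m x) = B (m x) (m x)" "B \<eta> (m x) = 0"
        by (simp_all add: m_def diff_left diff_right scaleR_left scaleR_right 1 2)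
    qed
    have FR2: "F (R2 x) = F x" for x
    proof -
      have "B (x - \<eta>) (m x) = B (m x) (m x)" by (simp add: diff_left B_m)
      then show ?thesis
        using reflect_isometry[of "x - \<eta>" "m x"] by (simp add: F_def R2_def algebra_simps)
    qed
    have kR2: "k (R2 x) = k x" for x
    proof -
      have "R2 x - Q (R2 x) = x - Q x" by (simp add: QR2) (simp add: R2_def)
      moreover have "P (R2 x) = P x - 2 *\<^sub>R m x" by (simp add: PR2 m_def scaleR_2)
      moreover have "B (P x - 2 *\<^sub>R m x) (P x - 2 *\<^sub>R m x) = B (P x) (P x)"
      proof (rule reflect_isometry)
        have "P (m x) = m x" by (simp add: m_def P.diff P.scale PP \<eta>)
        then show "B (P x) (m x) = B (m x) (m x)" by (simp add: adj_P B_m)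
      qed
      ultimately show ?thesis by (simp add: k_def excess_def)
    qed
    have hR2: "h (R2 x) = h x" for x by (simp add: h_def kR2 FR2 indicator_def)
    \<comment> \<open>Averaging over \<open>R2\<close> separates the part along \<eta> from the part
      along \<open>m x\<close>; dropping the latter leaves a scalar problem in
      \<open>1 + k \<tau>\<close>.\<close>
    have proj: "(\<integral>\<^sup>+x. ennreal ((1 + k x * \<tau> x)\<^sup>2) * q \<eta> * h x \<partial>lborel)
      \<le> (\<integral>\<^sup>+x. q (\<eta> + k x *\<^sub>R P x) * h x \<partial>lborel)"
    proof (rule nn_integral_involution_mono[OF R2_lin R2_inv])
      fix x
      let ?a = "(1 + k x * \<tau> x) *\<^sub>R \<eta>" and ?b = "k x *\<^sub>R m x"
      have "\<eta> + k x *\<^sub>R P x = ?a + ?b" "\<eta> + k x *\<^sub>R P (R2 x) = ?a - ?b"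
        by (simp_all add: PR2 m_def scaleR_add_left scaleR_add_right scaleR_diff_right)
      then have "(q (\<eta> + k x *\<^sub>R P x) + q (\<eta> + k x *\<^sub>R P (R2 x))) * h x = 2 * (q ?a + q ?b) * h x"
        by (simp only: q_par)
      moreover have "2 * q ?a * h x \<le> 2 * (q ?a + q ?b) * h x"
        by (intro mult_right_mono mult_left_mono) auto
      moreover have "ennreal ((1 + k x * \<tau> x)\<^sup>2) * q \<eta> * h x + ennreal ((1 + k (R2 x) * \<tau> (R2 x))\<^sup>2) * q \<eta> * h (R2 x)
        = 2 * q ?a * h x"
        by (simp only: hR2 kR2 \<tau>R2 q_scale mult_2 distrib_right)
      moreover have "q (\<eta> + k x *\<^sub>R P x) * h x + q (\<eta> + k (R2 x) *\<^sub>R P (R2 x)) * h (R2 x)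
        = (q (\<eta> + k x *\<^sub>R P x) + q (\<eta> + k x *\<^sub>R P (R2 x))) * h x"
        by (simp only: hR2 kR2 distrib_right)
      ultimately show "ennreal ((1 + k x * \<tau> x)\<^sup>2) * q \<eta> * h x + ennreal ((1 + k (R2 x) * \<tau> (R2 x))\<^sup>2) * q \<eta> * h (R2 x)
        \<le> q (\<eta> + k x *\<^sub>R P x) * h x + q (\<eta> + k (R2 x) *\<^sub>R P (R2 x)) * h (R2 x)"
        by (simp only:)
    qed measurable

    define R3 where "R3 x = x - 2 *\<^sub>R P x" for x
    have R3_lin: "linear R3"
      unfolding R3_def by (intro linear_compose_sub linear_compose_scale_right linear_ident bounded_linear.linear[OF lin_P])
    have PR3: "P (R3 x) = - P x" for x by (simp add: R3_def P.diff P.scale PP P.add scaleR_2)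
    have R3_inv: "R3 (R3 x) = x" for x by (simp add: R3_def[of "R3 x"] PR3) (simp add: R3_def)
    have [measurable]: "R3 \<in> borel_measurable borel" unfolding R3_def by measurable
    have kR3: "k (R3 x) = k x" for x
    proof -
      have "R3 x - Q (R3 x) = x - Q x" by (simp add: R3_def Q.diff Q.scale QP)
      then show ?thesis by (simp add: k_def excess_def PR3 minus_left minus_right)
    qed
    have \<tau>R3: "\<tau> (R3 x) = - \<tau> x" for x by (simp add: R3_def \<tau>.diff \<tau>.scale \<tau>P)
    have FR3: "F (R3 x) = G (B (x + \<eta>) (x + \<eta>))" for x
    proof -
      have "B (x + \<eta>) (P (x + \<eta>)) = B (P (x + \<eta>)) (P (x + \<eta>))" by (metis PP adj_P)
      then show ?thesis
        using reflect_isometry[of "x + \<eta>" "P (x + \<eta>)"]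
        by (simp add: F_def R3_def P.add \<eta> scaleR_2 algebra_simps)
    qed
    \<comment> \<open>This expresses that \<open>k \<tau>\<close> has nonnegative mean, with
      positive and negative parts kept apart. The factor 2 is that of the linear term of
      \<open>(1 + k \<tau>)^2\<close>.\<close>
    have corr: "(\<integral>\<^sup>+x. ennreal (2 * k x * max 0 (- \<tau> x)) * F x \<partial>lborel)
      \<le> (\<integral>\<^sup>+x. ennreal (2 * k x * max 0 (\<tau> x)) * F x \<partial>lborel)"
    proof -
      let ?c = "ennreal (2 / B \<eta> \<eta>)"
      have scale: "ennreal (2 * k x * max 0 (\<tau> x)) * z = ?c * (ennreal (k x * max 0 (B x \<eta>)) * z)" for x z
      proof -
        have "max 0 (\<tau> x) = max 0 (B x \<eta>) / B \<eta> \<eta>"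
          using B\<eta> by (auto simp: \<tau>_def max_def divide_simps)
        then have "2 * k x * max 0 (\<tau> x) = 2 / B \<eta> \<eta> * (k x * max 0 (B x \<eta>))" by simp
        then have "ennreal (2 * k x * max 0 (\<tau> x)) = ennreal (2 / B \<eta> \<eta> * (k x * max 0 (B x \<eta>)))"
          by (simp only:)
        also have "\<dots> = ?c * ennreal (k x * max 0 (B x \<eta>))"
          using B\<eta> k0[of x] by (intro ennreal_mult) auto
        finally show ?thesis by (simp only: mult.assoc)
      qed
      have "(\<integral>\<^sup>+x. ennreal (2 * k x * max 0 (- \<tau> x)) * F x \<partial>lborel)
        = (\<integral>\<^sup>+x. ennreal (2 * k (R3 x) * max 0 (- \<tau> (R3 x))) * F (R3 x) \<partial>lborel)"
        by (rule nn_integral_linear_involution[OF R3_lin R3_inv, symmetric]) measurable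
      also have "\<dots> = ?c * (\<integral>\<^sup>+x. ennreal (k x * max 0 (B x \<eta>)) * G (B (x + \<eta>) (x + \<eta>)) \<partial>lborel)"
        by (simp add: kR3 \<tau>R3 FR3 scale nn_integral_cmult)
      also have "\<dots> \<le> ?c * (\<integral>\<^sup>+x. ennreal (k x * max 0 (B x \<eta>)) * G (B (x - \<eta>) (x - \<eta>)) \<partial>lborel)"
        unfolding k_def by (intro mult_left_mono spherical_correlation[OF e f \<eta> \<kappa> G]) auto
      also have "\<dots> = (\<integral>\<^sup>+x. ennreal (2 * k x * max 0 (\<tau> x)) * F x \<partial>lborel)"
        by (simp add: scale F_def nn_integral_cmult)
      finally show ?thesis .
    qed

    \<comment> \<open>Off the support of \<open>h\<close> the factor \<open>k\<close> vanishes;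
      \<open>s\<close> will be 1 or -1, selecting a sign of \<tau>.\<close>
    have split: "ennreal (2 * k x * max 0 (s * \<tau> x)) * F x = ennreal (2 * k x * max 0 (s * \<tau> x)) * h x" for x s
      using k0[of x] by (cases "k x = 0") (auto simp: h_def indicator_def)
    \<comment> \<open>Splitting by the sign of \<open>\<tau>\<close> lets \<open>corr\<close> be used without subtracting possibly
      infinite integrals.\<close>
    define A where "A x = indicator {x. 0 \<le> \<tau> x} x * h x + indicator {x. \<tau> x < 0} x * (ennreal ((1 + k x * \<tau> x)\<^sup>2) * h x)" for x
    have [measurable]: "A \<in> borel_measurable borel" unfolding A_def by measurable
    \<comment> \<open>The two pointwise estimates of this chain are
      \<open>1 + 2 k \<tau> \<le> (1 + k \<tau>)^2\<close>, with the linear term moved to the left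
      or right by the sign of \<tau>; \<open>corr\<close> links them.\<close>
    have "(\<integral>\<^sup>+x. h x \<partial>lborel) \<le> (\<integral>\<^sup>+x. A x + ennreal (2 * k x * max 0 (- \<tau> x)) * F x \<partial>lborel)"
    proof (rule nn_integral_mono)
      fix x
      show "h x \<le> A x + ennreal (2 * k x * max 0 (- \<tau> x)) * F x"
      proof (cases "\<tau> x < 0")
        case True
        have "(1::ennreal) \<le> ennreal ((1 + k x * \<tau> x)\<^sup>2 + 2 * k x * (- \<tau> x))"
          unfolding ennreal_1[symmetric] by (intro ennreal_leI) (simp add: power2_sum)
        also have "\<dots> = ennreal ((1 + k x * \<tau> x)\<^sup>2) + ennreal (2 * k x * (- \<tau> x))"
          using True k0[of x] by (intro ennreal_plus) (auto intro!: mult_nonneg_nonpos simp: mult_nonneg_nonpos)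
        finally have "1 * h x \<le> (ennreal ((1 + k x * \<tau> x)\<^sup>2) + ennreal (2 * k x * (- \<tau> x))) * h x"
          by (rule mult_right_mono) simp
        then show ?thesis
          using True split[of x "-1"] by (simp add: A_def distrib_right max_def)
      qed (simp add: A_def)
    qed
    also have "\<dots> = (\<integral>\<^sup>+x. A x \<partial>lborel) + (\<integral>\<^sup>+x. ennreal (2 * k x * max 0 (- \<tau> x)) * F x \<partial>lborel)"
      by (rule nn_integral_add) measurable
    also have "\<dots> \<le> (\<integral>\<^sup>+x. A x \<partial>lborel) + (\<integral>\<^sup>+x. ennreal (2 * k x * max 0 (\<tau> x)) * F x \<partial>lborel)"
      by (intro add_left_mono corr)
    also have "\<dots> = (\<integral>\<^sup>+x. A x + ennreal (2 * k x * max 0 (\<tau> x)) * F x \<partial>lborel)"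
      by (rule nn_integral_add[symmetric]) measurable
    also have "\<dots> \<le> (\<integral>\<^sup>+x. ennreal ((1 + k x * \<tau> x)\<^sup>2) * h x \<partial>lborel)"
    proof (rule nn_integral_mono)
      fix x
      show "A x + ennreal (2 * k x * max 0 (\<tau> x)) * F x \<le> ennreal ((1 + k x * \<tau> x)\<^sup>2) * h x"
      proof (cases "\<tau> x < 0")
        case False
        have "1 + ennreal (2 * k x * \<tau> x) = ennreal (1 + 2 * k x * \<tau> x)"
          using False k0[of x] by simp
        also have "\<dots> \<le> ennreal ((1 + k x * \<tau> x)\<^sup>2)"
          by (intro ennreal_leI) (simp add: power2_sum)
        finally have "(1 + ennreal (2 * k x * \<tau> x)) * h x \<le> ennreal ((1 + k x * \<tau> x)\<^sup>2) * h x"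
          by (rule mult_right_mono) simp
        then show ?thesis
          using False split[of x 1] by (simp add: A_def distrib_right max_def)
      qed (simp add: A_def)
    qed
    finally have "q \<eta> * (\<integral>\<^sup>+x. h x \<partial>lborel) \<le> q \<eta> * (\<integral>\<^sup>+x. ennreal ((1 + k x * \<tau> x)\<^sup>2) * h x \<partial>lborel)"
      by (rule mult_left_mono) simp
    also have "\<dots> = (\<integral>\<^sup>+x. ennreal ((1 + k x * \<tau> x)\<^sup>2) * q \<eta> * h x \<partial>lborel)"
      by (simp add: nn_integral_cmult[symmetric] mult_ac)
    finally show ?thesis using proj by (rule order_trans)
  qed

  have loss: "loss c x = q (u x - \<eta> + c *\<^sub>R P x)" for c x
    by (simp add: loss_def q_def u_def)
  \<comment> \<open>The contribution where the excess is 0, which both risks share.\<close>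
  define r where "r x = indicator {x. \<not> 0 < k x} x * q (u x - \<eta> + p x *\<^sub>R P x) * F x" for x
  have [measurable]: "r \<in> borel_measurable borel" unfolding r_def by measurable
  have p0: "p x = 0" if "0 < k x" for x using pk[of x] that by (auto simp: k_def)
  have kneg: "k x = 0" if "\<not> 0 < k x" for x using k0[of x] that by simp
  have "(\<integral>\<^sup>+x. loss (p x) x * F x \<partial>lborel) = (\<integral>\<^sup>+x. r x + q (u x + - \<eta>) * h x \<partial>lborel)"
    by (intro nn_integral_cong) (auto simp: loss r_def h_def p0 indicator_def)
  also have "\<dots> = (\<integral>\<^sup>+x. r x \<partial>lborel) + ((\<integral>\<^sup>+x. q (u x) * h x \<partial>lborel) + q \<eta> * (\<integral>\<^sup>+x. h x \<partial>lborel))"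
    by (subst nn_integral_add) (auto simp: cross q_minus nn_integral_cmult simp del: add_uminus_conv_diff)
  also have "\<dots> \<le> (\<integral>\<^sup>+x. r x \<partial>lborel) + ((\<integral>\<^sup>+x. q (u x) * h x \<partial>lborel) + (\<integral>\<^sup>+x. q (\<eta> + k x *\<^sub>R P x) * h x \<partial>lborel))"
    by (intro add_left_mono main)
  also have "(\<integral>\<^sup>+x. q (\<eta> + k x *\<^sub>R P x) * h x \<partial>lborel) = (\<integral>\<^sup>+x. q (- (\<eta> + k x *\<^sub>R P x)) * h x \<partial>lborel)"
    by (simp only: q_minus)
  also have "(\<integral>\<^sup>+x. q (u x) * h x \<partial>lborel) + \<dots> = (\<integral>\<^sup>+x. q (u x + - (\<eta> + k x *\<^sub>R P x)) * h x \<partial>lborel)"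
    by (rule cross[symmetric]) (auto simp: kR1 PR1)
  also have "(\<integral>\<^sup>+x. r x \<partial>lborel) + \<dots> = (\<integral>\<^sup>+x. r x + q (u x + - (\<eta> + k x *\<^sub>R P x)) * h x \<partial>lborel)"
    by (rule nn_integral_add[symmetric]) measurable
  also have "\<dots> = (\<integral>\<^sup>+x. loss (p x - k x) x * F x \<partial>lborel)"
    by (intro nn_integral_cong) (auto simp: loss r_def h_def p0 kneg indicator_def algebra_simps)
  finally show ?thesis by (simp add: F_def k_def)
qed

end

section \<open>The regression model\<close>

declare transpose_matrix_vector [simp del]

lemma inner_matrix_vector_transpose:
  fixes M :: "real^'n^'m"
  shows "(M *v x) \<bullet> y = x \<bullet> (transpose M *v y)"
  by (metis dot_lmul_matrix inner_commute transpose_matrix_vector)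

lemma matrix_inv_vector:
  fixes A :: "real^'n^'n"
  assumes "invertible A"
  shows "matrix_inv A *v (A *v x) = x" and "A *v (matrix_inv A *v x) = x"
proof -
  have "A ** matrix_inv A = mat 1 \<and> matrix_inv A ** A = mat 1"
    using assms unfolding invertible_def matrix_inv_def by (rule someI_ex)
  then show "matrix_inv A *v (A *v x) = x" "A *v (matrix_inv A *v x) = x"
    by (simp_all add: matrix_vector_mul_assoc)
qed

section \<open>Positive definite matrices\<close>

lemma pos_def_matrix_inner: "pos_def_matrix A \<Longrightarrow> (A *v x) \<bullet> y = x \<bullet> (A *v y)"
  by (simp add: pos_def_matrix_def inner_matrix_vector_transpose)

lemma pos_def_matrix_invertible:
  fixes A :: "real^'n^'n"
  assumes "pos_def_matrix A"
  shows "invertible A"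
proof -
  have "A *v x = 0 \<Longrightarrow> x = 0" for x
    using assms by (metis inner_zero_right less_irrefl pos_def_matrix_def)
  then show ?thesis
    unfolding invertible_left_inverse matrix_left_invertible_ker by blast
qed

lemma pos_def_matrix_inv:
  fixes A :: "real^'n^'n"
  assumes A: "pos_def_matrix A"
  shows "pos_def_matrix (matrix_inv A)"
proof -
  note inv = matrix_inv_vector[OF pos_def_matrix_invertible[OF A]]
  have "(transpose (matrix_inv A) *v x) \<bullet> y = (matrix_inv A *v x) \<bullet> y" for x y
  proof -
    have "(transpose (matrix_inv A) *v x) \<bullet> y = x \<bullet> (matrix_inv A *v y)"
      by (simp add: inner_matrix_vector_transpose transpose_transpose)
    also have "\<dots> = (A *v (matrix_inv A *v x)) \<bullet> (matrix_inv A *v y)" by (simp add: inv)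
    also have "\<dots> = (matrix_inv A *v x) \<bullet> y" using pos_def_matrix_inner[OF A, of "matrix_inv A *v x" "matrix_inv A *v y"] by (simp only: inv)
    finally show ?thesis .
  qed
  then have "transpose (matrix_inv A) = matrix_inv A"
    by (metis matrix_eq vector_eq_rdot)
  moreover have "0 < x \<bullet> (matrix_inv A *v x)" if "x \<noteq> 0" for x
  proof -
    have "matrix_inv A *v x \<noteq> 0" using that inv(2)[of x] by (metis matrix_vector_mult_0_right)
    then have "0 < (matrix_inv A *v x) \<bullet> (A *v (matrix_inv A *v x))"
      using A by (simp add: pos_def_matrix_def)
    then show ?thesis by (simp add: inv inner_commute)
  qed
  ultimately show ?thesis by (simp add: pos_def_matrix_def)
qed

lemma pos_def_matrix_congruence:
  fixes A :: "real^'n^'n" and Y :: "real^'m^'n"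
  assumes A: "pos_def_matrix A" and inj: "\<And>x. Y *v x = 0 \<Longrightarrow> x = 0"
  shows "pos_def_matrix (transpose Y ** A ** Y)"
  unfolding pos_def_matrix_def
proof (intro conjI allI impI)
  show "transpose (transpose Y ** A ** Y) = transpose Y ** A ** Y"
    using A by (simp add: pos_def_matrix_def matrix_transpose_mul matrix_mul_assoc)
  fix x :: "real^'m" assume "x \<noteq> 0"
  then have "0 < (Y *v x) \<bullet> (A *v (Y *v x))"
    using A inj unfolding pos_def_matrix_def by blast
  then show "0 < x \<bullet> ((transpose Y ** A ** Y) *v x)"
    by (simp add: inner_matrix_vector_transpose matrix_vector_mul_assoc matrix_mul_assoc)
qed

section \<open>Rank and kernels\<close>

lemma nontrivial_kernel:
  fixes A :: "real^'n^'m"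
  assumes "CARD('m) < CARD('n)"
  obtains x where "x \<noteq> 0" "A *v x = 0"
proof -
  have "rank A < CARD('n)" using rank_bound[of A] assms by linarith
  then show thesis using less_rank_noninjective[of A] that
    by (metis (no_types, lifting) full_rank_injective matrix_left_invertible_injective matrix_left_invertible_ker)
qed

lemma full_column_rank_kernel:
  fixes A :: "real^'n^'m"
  assumes "rank A = CARD('n)" "A *v x = 0"
  shows "x = 0"
  using assms by (metis full_rank_injective matrix_left_invertible_injective matrix_left_invertible_ker)

theorem mainTheorem7:
  fixes M :: "'w measure"
    and X :: "real^'p^'n" and V :: "real^'n^'n"
    and H :: "real^'p^'q" and h :: "real^'q"
    and W :: "real^'p^'p"
    and \<sigma> d :: real and g :: "real \<Rightarrow> real"
    and \<mu> :: "real set \<Rightarrow> real" and \<mu>p \<mu>n :: "real measure"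
    and \<epsilon> :: "'w \<Rightarrow> real^'n"
  assumes "prob_space M"
    and "CARD('p) < CARD('n)" and "rank X = CARD('p)"
    and "pos_def_matrix V" and "\<sigma> > 0"
    and "CARD('q) < CARD('p)" and "rank H = CARD('q)" and "CARD('q) \<ge> 3"
    and "pos_def_matrix W"
    and "\<And>s. s \<ge> 0 \<Longrightarrow> g s \<ge> 0"
    and "mixing_measure \<mu> \<mu>p \<mu>n"
    and "elliptical_mixture \<sigma> V g \<mu>p \<mu>n"
    and "distributed M lborel \<epsilon> (\<lambda>x. ennreal (elliptical_density \<sigma> V g x))"
    and "d = shrink_const (real CARD('q)) (real CARD('n) - real CARD('p))"
  shows "\<forall>\<beta> :: real^'p.
    quad_risk M W (\<lambda>\<omega>. stein_plus d X V H h (X *v \<beta> + \<epsilon> \<omega>)) \<beta>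
      \<le> quad_risk M W (\<lambda>\<omega>. stein d X V H h (X *v \<beta> + \<epsilon> \<omega>)) \<beta>"
proof
  fix \<beta> :: "real^'p"
  define A where "A = matrix_inv V"
  define Ci where "Ci = matrix_inv (gram X V)"
  define V\<^sub>1 where "V\<^sub>1 = V1 X V H"
  \<comment> \<open>\<open>K\<close> turns a violation of the restriction into the correction made
    by the restricted estimator; it is a right inverse of \<open>H\<close>, see
    \<open>HK\<close>.\<close>
  define K where "K = Ci ** transpose H ** V\<^sub>1"
  define L where "L = gls X V"
  define m where "m = real CARD('n) - real CARD('p)"
  define q where "q = real CARD('q)"
  have m: "0 < m" using assms(2) by (simp add: m_def)
  have q: "2 < q" using assms(8) by (simp add: q_def)
  have d: "0 < d" using m q by (simp add: assms(14) shrink_const_def flip: m_def q_def)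

  have injX: "X *v b = 0 \<Longrightarrow> b = 0" for b by (rule full_column_rank_kernel[OF assms(3)])
  have injH: "transpose H *v b = 0 \<Longrightarrow> b = 0" for b
    by (rule full_column_rank_kernel[of "transpose H"]) (simp_all add: assms(7) rank_transpose)
  have A: "pos_def_matrix A" unfolding A_def by (rule pos_def_matrix_inv[OF assms(4)])
  have C: "pos_def_matrix (gram X V)"
    unfolding gram_def using pos_def_matrix_congruence[OF A injX] by (simp add: A_def)
  have Ci: "pos_def_matrix Ci" unfolding Ci_def by (rule pos_def_matrix_inv[OF C])
  have HCH: "pos_def_matrix (H ** Ci ** transpose H)"
    using pos_def_matrix_congruence[OF Ci, of "transpose H"] injH by (simp add: transpose_transpose)
  have V\<^sub>1_eq: "V\<^sub>1 = matrix_inv (H ** Ci ** transpose H)" by (simp add: V\<^sub>1_def V1_def Ci_def)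
  have V\<^sub>1: "pos_def_matrix V\<^sub>1" unfolding V\<^sub>1_eq by (rule pos_def_matrix_inv[OF HCH])

  have L: "L y = Ci *v (transpose X *v (A *v y))" for y by (simp add: L_def gls_def Ci_def A_def)
  have lin_L: "bounded_linear L"
    unfolding L_def gls_def matrix_vector_mul_assoc by (rule matrix_vector_mul_bounded_linear)
  interpret L: bounded_linear L by (rule lin_L)
  have LX: "L (X *v b) = b" for b
    using matrix_inv_vector(1)[OF pos_def_matrix_invertible[OF C], of b]
    by (simp add: L Ci_def A_def gram_def matrix_vector_mul_assoc matrix_mul_assoc)
  have HK: "H *v (K *v v) = v" for v
    using matrix_inv_vector(2)[OF pos_def_matrix_invertible[OF HCH], of v]
    by (simp add: K_def V\<^sub>1_eq matrix_vector_mul_assoc matrix_mul_assoc)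

  define B where "B x y = x \<bullet> (A *v y)" for x y
  \<comment> \<open>\<open>Q\<close> gives the fitted values, projecting onto the column space of
    \<open>X\<close>. \<open>P\<close> projects onto the image of \<open>X ** K\<close>, the part of
    the fit that \<open>H\<close> detects.\<close>
  define Q where "Q x = X *v L x" for x
  define P where "P x = X *v (K *v (H *v L x))" for x
  have LP: "L (P x) = K *v (H *v L x)" and LQ: "L (Q x) = L x" for x
    by (simp_all add: P_def Q_def LX)
  have B_range: "B (X *v b) y = b \<bullet> (transpose X *v (A *v y))" for b y
    by (simp add: B_def inner_matrix_vector_transpose)
  have B_sym: "B x y = B y x" for x y
    unfolding B_def by (metis pos_def_matrix_inner[OF A] inner_commute)
  \<comment> \<open>This form and the next are symmetric in \<open>x\<close> and \<open>y\<close>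
    because \<open>Ci\<close> and \<open>V\<^sub>1\<close> are, which gives self-adjointness of
    \<open>Q\<close> and \<open>P\<close>.\<close>
  have B_Q: "B (Q x) y = (transpose X *v (A *v x)) \<bullet> (Ci *v (transpose X *v (A *v y)))" for x y
    by (simp add: Q_def B_range L pos_def_matrix_inner[OF Ci])
  have B_P: "B (P x) y = (H *v L x) \<bullet> (V\<^sub>1 *v (H *v L y))" for x y
  proof -
    have "B (P x) y = (Ci *v (transpose H *v (V\<^sub>1 *v (H *v L x)))) \<bullet> (transpose X *v (A *v y))"
      by (simp add: P_def B_range K_def flip: matrix_vector_mul_assoc)
    also have "\<dots> = (V\<^sub>1 *v (H *v L x)) \<bullet> (H *v L y)"
      by (simp only: pos_def_matrix_inner[OF Ci] inner_matrix_vector_transpose[of "transpose H"]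
          transpose_transpose L[symmetric])
    finally show ?thesis by (simp add: pos_def_matrix_inner[OF V\<^sub>1])
  qed
  have bil_B: "bounded_bilinear B"
    unfolding B_def
    by (rule bounded_bilinear.comp[OF bounded_bilinear_inner bounded_linear_ident matrix_vector_mul_bounded_linear])
  interpret orthogonal_projections B P Q
  proof (intro orthogonal_projections.intro orthogonal_projections_axioms.intro)
    show "bounded_linear P" "bounded_linear Q"
      unfolding P_def Q_def
      by (intro bounded_linear_compose[OF matrix_vector_mul_bounded_linear] lin_L)+
    show "B (P x) y = B x (P y)" for x y
      using B_P[of x y] B_P[of y x] B_sym[of x "P y"] pos_def_matrix_inner[OF V\<^sub>1]
      by (simp add: inner_commute)
    show "B (Q x) y = B x (Q y)" for x y
      using B_Q[of x y] B_Q[of y x] B_sym[of x "Q y"] pos_def_matrix_inner[OF Ci]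
      by (simp add: inner_commute)
    show "P (P x) = P x" "Q (Q x) = Q x" "Q (P x) = P x" for x
      by (simp_all add: P_def Q_def LX HK)
    show "0 < B x x" if "x \<noteq> 0" for x
      using A that by (simp add: B_def pos_def_matrix_def)
  qed (rule bil_B B_sym)+

  have unit: "B (x /\<^sub>R sqrt (B x x)) (x /\<^sub>R sqrt (B x x)) = 1" if "x \<noteq> 0" for x
    using pos[OF that] by (simp add: scaleR_left scaleR_right divide_simps)
  \<comment> \<open>As \<open>q < p\<close>, some nonzero coefficient vector is invisible to
    \<open>H\<close>; its image under \<open>X\<close> is normalised.\<close>
  obtain e where e: "Q e = e" "P e = 0" "B e e = 1"
  proof -
    obtain b where b: "b \<noteq> 0" "H *v b = 0" using nontrivial_kernel[OF assms(6)] .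
    then have "X *v b \<noteq> 0" using injX by blast
    with that[of "(X *v b) /\<^sub>R sqrt (B (X *v b) (X *v b))"] b unit show thesis
      by (simp add: P.scale Q.scale) (simp add: P_def Q_def LX)
  qed
  \<comment> \<open>As \<open>p < n\<close>, some nonzero vector is \<open>B\<close>-orthogonal to
    the column space of \<open>X\<close>.\<close>
  obtain f where f: "Q f = 0" "B f f = 1"
  proof -
    obtain b where b: "b \<noteq> 0" "(transpose X ** A) *v b = 0" using nontrivial_kernel[OF assms(2)] .
    then have "Q b = 0" by (simp add: Q_def L matrix_vector_mul_assoc)
    with that[of "b /\<^sub>R sqrt (B b b)"] b unit show thesis by (simp add: Q.scale)
  qed

  define \<theta> where "\<theta> = H *v \<beta> - h"
  \<comment> \<open>Since \<open>H K \<theta> = \<theta>\<close>, the statistics of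
    \<open>X \<beta> + z\<close> depend on \<open>x = z + \<eta>\<close> as if the restriction were
    homogeneous; the density of \<open>x\<close> is centred at \<eta>.\<close>
  define \<eta> where "\<eta> = X *v (K *v \<theta>)"
  have \<eta>: "P \<eta> = \<eta>" by (simp add: P_def \<eta>_def LX HK)
  have L\<eta>: "L \<eta> = K *v \<theta>" by (simp add: \<eta>_def LX)
  define N where "N x y = L x \<bullet> (W *v L y)" for x y
  have bil_N: "bounded_bilinear N"
    unfolding N_def
    by (rule bounded_bilinear.comp[OF bounded_bilinear_inner lin_L
          bounded_linear_compose[OF matrix_vector_mul_bounded_linear lin_L]])
  have N_pos: "0 \<le> N x x" for x
    using assms(9) by (cases "L x = 0") (auto simp: N_def pos_def_matrix_def less_imp_le)
  define T where "T x = B (P x) (P x) / (q * (B (x - Q x) (x - Q x) / m))" for x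
  have T0: "0 \<le> T x" for x using nonneg m q by (simp add: T_def)
  \<comment> \<open>\<open>c\<close> and \<open>p\<close> are the factors of \<open>P x\<close> in
    the errors of the Stein and the positive rule.\<close>
  define c where "c x = 1 - d * inverse (T x)" for x
  define p where "p x = c x * indicator {d<..} (T x)" for x
  have [measurable]: "T \<in> borel_measurable borel" unfolding T_def by measurable
  have [measurable]: "c \<in> borel_measurable borel" unfolding c_def by measurable
  have [measurable]: "p \<in> borel_measurable borel" unfolding p_def by measurable
  define \<kappa> where "\<kappa> = d * q / m"
  have \<kappa>: "0 \<le> \<kappa>" using d q m by (simp add: \<kappa>_def)
  have excess: "excess \<kappa> x = max 0 (d * inverse (T x) - 1)" for x
    by (simp add: excess_def \<kappa>_def T_def ac_simps)
  have T_gt: "d * inverse (T x) < 1" if "d < T x" for x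
    using that d by (simp add: divide_simps)
  have pk: "p x * excess \<kappa> x = 0" for x
    using T_gt[of x] by (auto simp: p_def excess indicator_def)
  \<comment> \<open>At \<open>T x = 0\<close> the convention \<open>inverse 0 = 0\<close> gives
    \<open>c x = 1\<close>, while \<open>p x\<close> and the excess are 0.\<close>
  have c_eq: "c x = p x - excess \<kappa> x" if "T x \<noteq> 0" for x
  proof (cases "d < T x")
    case True
    then show ?thesis using T_gt[of x] by (simp add: p_def excess c_def)
  next
    case False
    then have "1 \<le> d * inverse (T x)" using that T0[of x] by (simp add: divide_simps)
    then show ?thesis using False by (simp add: p_def excess c_def)
  qed

  \<comment> \<open>The radial profile is read off the density along the unit vector
    \<open>e\<close>, so it inherits measurability from the density, none being assumed of
    \<open>g\<close>.\<close>
  define G where "G s = ennreal (elliptical_density \<sigma> V g (sqrt (max 0 s) *\<^sub>R e))" for s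
  have [measurable]: "(\<lambda>x. ennreal (elliptical_density \<sigma> V g x)) \<in> borel_measurable borel"
    using distributed_borel_measurable[OF assms(13)] by simp
  have G: "G \<in> borel_measurable borel" unfolding G_def by measurable
  note [measurable] = G
  have density: "ennreal (elliptical_density \<sigma> V g x) = G (B x x)" for x
  proof -
    have "B (sqrt (B x x) *\<^sub>R e) (sqrt (B x x) *\<^sub>R e) = B x x"
      using nonneg[of x] by (simp add: scaleR_left scaleR_right e)
    then show ?thesis
      using nonneg[of x] by (simp add: G_def elliptical_density_def max_def flip: A_def B_def)
  qed

  \<comment> \<open>Statistics, errors and risks in terms of the shifted error\<close>
  have residual: "X *v \<beta> + z - X *v L (X *v \<beta> + z) = z + \<eta> - Q (z + \<eta>)" for z
    by (simp add: L.add LX Q_def L\<eta> matrix_vector_right_distrib \<eta>_def)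
  have deviation: "H *v L (X *v \<beta> + z) - h = H *v L (z + \<eta>)" for z
    by (simp add: L.add LX L\<eta> matrix_vector_right_distrib HK \<theta>_def)
  have statistic: "test_stat X V H h (X *v \<beta> + z) = T (z + \<eta>)" for z
  proof -
    have "S2 X V (X *v \<beta> + z) = B (z + \<eta> - Q (z + \<eta>)) (z + \<eta> - Q (z + \<eta>)) / m"
      by (simp add: S2_def m_def residual B_def flip: L_def A_def)
    moreover have "B (P (z + \<eta>)) (P (z + \<eta>)) = B (P (z + \<eta>)) (z + \<eta>)"
      by (metis PP adj_P)
    ultimately show ?thesis
      by (simp add: test_stat_def T_def deviation B_P flip: L_def V\<^sub>1_def q_def)
  qed
  have restr: "restricted X V H h (X *v \<beta> + z) = L (X *v \<beta> + z) - K *v (H *v L (z + \<eta>))" for z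
    by (simp add: restricted_def deviation K_def flip: L_def V\<^sub>1_def Ci_def)
  have error: "L (Q x - P x - \<eta> + s *\<^sub>R P x) = L x - K *v \<theta> - (1 - s) *\<^sub>R (K *v (H *v L x))" for x s
    by (simp add: L.add L.diff L.scale LP LQ L\<eta> algebra_simps)
  have error_stein: "stein d X V H h (X *v \<beta> + z) - \<beta> =
      L (Q (z + \<eta>) - P (z + \<eta>) - \<eta> + c (z + \<eta>) *\<^sub>R P (z + \<eta>))" for z
    unfolding error by (simp add: stein_def statistic restr c_def L.add LX L\<eta> flip: L_def)
  have error_stein_plus: "stein_plus d X V H h (X *v \<beta> + z) - \<beta> =
      L (Q (z + \<eta>) - P (z + \<eta>) - \<eta> + p (z + \<eta>) *\<^sub>R P (z + \<eta>))" for z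
    unfolding error scaleR_left_diff_distrib
    by (simp add: stein_plus_def statistic restr c_def p_def L.add LX L\<eta> flip: L_def)

  have [measurable]: "L \<in> borel_measurable borel"
    by (intro borel_measurable_continuous_onI linear_continuous_on lin_L)
  have [measurable]: "(\<lambda>x. W *v x) \<in> borel_measurable borel"
    by (intro borel_measurable_continuous_onI linear_continuous_on matrix_vector_mul_bounded_linear)
  define loss where "loss s x = ennreal (N (Q x - P x - \<eta> + s *\<^sub>R P x) (Q x - P x - \<eta> + s *\<^sub>R P x))" for s x
  have risk: "quad_risk M W (\<lambda>\<omega>. b (X *v \<beta> + \<epsilon> \<omega>)) \<beta> =
      (\<integral>\<^sup>+x. loss (s x) x * G (B (x - \<eta>) (x - \<eta>)) \<partial>lborel)"
    if [measurable]: "s \<in> borel_measurable borel"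
      and b: "\<And>z. b (X *v \<beta> + z) - \<beta> = L (Q (z + \<eta>) - P (z + \<eta>) - \<eta> + s (z + \<eta>) *\<^sub>R P (z + \<eta>))" for b s
  proof -
    have [measurable]: "(\<lambda>x. loss (s x) x) \<in> borel_measurable borel"
      unfolding loss_def N_def by measurable
    have "quad_risk M W (\<lambda>\<omega>. b (X *v \<beta> + \<epsilon> \<omega>)) \<beta> = (\<integral>\<^sup>+\<omega>. loss (s (\<epsilon> \<omega> + \<eta>)) (\<epsilon> \<omega> + \<eta>) \<partial>M)"
      by (simp add: quad_risk_def b loss_def N_def)
    also have "\<dots> = (\<integral>\<^sup>+z. G (B z z) * loss (s (z + \<eta>)) (z + \<eta>) \<partial>lborel)"
      by (subst distributed_nn_integral[OF assms(13), symmetric]) (simp_all add: density)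
    also have "\<dots> = (\<integral>\<^sup>+x. loss (s x) x * G (B (x - \<eta>) (x - \<eta>)) \<partial>lborel)"
      using nn_integral_lborel_translate[of "\<lambda>x. loss (s x) x * G (B (x - \<eta>) (x - \<eta>))" \<eta>]
      by (simp add: mult.commute)
    finally show ?thesis .
  qed

  \<comment> \<open>Where the residual vanishes, \<open>L\<^sub>n\<close> has the junk value 0 and the two estimators are
    not related by the excess.\<close>
  have AE_residual: "AE x in lborel. x - Q x \<noteq> 0"
  proof -
    have "f \<noteq> 0" using f zero_left by auto
    then have "A *v f \<noteq> 0"
      using matrix_inv_vector(1)[OF pos_def_matrix_invertible[OF A], of f]
      by (metis matrix_vector_mult_0_right)
    \<comment> \<open>A vanishing residual would force \<open>B x f = 0\<close>, and this is a
      hyperplane because \<open>A *v f\<close> is nonzero.\<close>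
    then have "negligible {x. (A *v f) \<bullet> x = 0}" by (intro negligible_hyperplane) auto
    then have "AE x in lebesgue. \<not> (A *v f) \<bullet> x = 0"
      by (simp add: negligible_iff_null_sets AE_iff_null_sets)
    then have "AE x in lborel. \<not> (A *v f) \<bullet> x = 0" by (simp add: AE_completion_iff)
    then show ?thesis
    proof (rule AE_mp, intro AE_I2 impI)
      fix x assume x: "\<not> (A *v f) \<bullet> x = 0"
      show "x - Q x \<noteq> 0"
      proof
        assume "x - Q x = 0"
        then have "B x f = B x (Q f)" by (metis adj_Q eq_iff_diff_eq_0)
        with x show False by (simp add: f zero_right) (simp add: B_def inner_commute)
      qed
    qed
  qed
  have "quad_risk M W (\<lambda>\<omega>. stein_plus d X V H h (X *v \<beta> + \<epsilon> \<omega>)) \<beta> =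
      (\<integral>\<^sup>+x. loss (p x) x * G (B (x - \<eta>) (x - \<eta>)) \<partial>lborel)"
    by (rule risk) (simp_all add: error_stein_plus)
  also have "\<dots> \<le> (\<integral>\<^sup>+x. loss (p x - excess \<kappa> x) x * G (B (x - \<eta>) (x - \<eta>)) \<partial>lborel)"
    unfolding loss_def
    by (rule truncation_risk_le[OF e f \<eta> \<kappa> G bil_N N_pos _ pk]) measurable
  also have "\<dots> = (\<integral>\<^sup>+x. loss (c x) x * G (B (x - \<eta>) (x - \<eta>)) \<partial>lborel)"
  proof (rule nn_integral_cong_AE, rule AE_mp[OF AE_residual], intro AE_I2 impI)
    fix x assume x: "x - Q x \<noteq> 0"
    have "loss (p x - excess \<kappa> x) x = loss (c x) x"
    \<comment> \<open>Where \<open>P x = 0\<close> its coefficient does not affect the loss;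
      elsewhere \<open>T x\<close> is nonzero and \<open>c_eq\<close> applies.\<close>
    proof (cases "P x = 0")
      case False
      then have "T x \<noteq> 0" using pos[OF x] pos[OF False] m q by (simp add: T_def)
      then show ?thesis by (simp add: c_eq)
    qed (simp add: loss_def)
    then show "loss (p x - excess \<kappa> x) x * G (B (x - \<eta>) (x - \<eta>)) = loss (c x) x * G (B (x - \<eta>) (x - \<eta>))"
      by simp
  qed
  also have "\<dots> = quad_risk M W (\<lambda>\<omega>. stein d X V H h (X *v \<beta> + \<epsilon> \<omega>)) \<beta>"
    by (rule risk[symmetric]) (simp_all add: error_stein)
  finally show "quad_risk M W (\<lambda>\<omega>. stein_plus d X V H h (X *v \<beta> + \<epsilon> \<omega>)) \<beta>
      \<le> quad_risk M W (\<lambda>\<omega>. stein d X V H h (X *v \<beta> + \<epsilon> \<omega>)) \<beta>" .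
qed

end
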